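(* There is no $K\in\mathbb{R}$ and $\beta>0$ such that the metric measure space $(\mathcal{G}_0,d^{L^2},\mathbb{Q}^\beta_0)$ has generalized $\mathrm{Ric}\ge K$.
   Context: $\mathcal{G}_0\subset L^2([0,1])$ is the set of right continuous, nondecreasing functions $g:[0,1]\to[0,1]$ with $g(1)=1$ (regarded as elements of $L^2([0,1])$; $g(t)$ refers to this right continuous representative), and $d^{L^2}(f,g)=\|f-g\|_{L^2([0,1])}$. This is a compact geodesic metric space. For $\beta>0$, the entropic measure $\mathbb{Q}^\beta_0$ is the unique Borel probability measure on $(\mathcal{G}_0,d^{L^2})$ such that for every partition $0=t_0<t_1<\dots<t_N<t_{N+1}=1$ and every bounded measurable $u:[0,1]^N\to\mathbb{R}$, $$\int_{\mathcal{G}_0}u(g(t_1),\dots,g(t_N))\,d\mathbb{Q}^\beta_0(g)=\frac{\Gamma(\beta)}{\prod_{i=0}^N\Gamma(\beta(t_{i+1}-t_i))}\int_{\Sigma_N}u(x_1,\dots,x_N)\prod_{i=0}^N(x_{i+1}-x_i)^{\beta(t_{i+1}-t_i)-1}\,dx_1\cdots dx_N,$$ where $\Sigma_N=\{(x_1,\dots,x_N)\in[0,1]^N:0=x_0<x_1<\dots<x_N<x_{N+1}=1\}$, with $x_0=0$, $x_{N+1}=1$, and $\Gamma$ is the Gamma function. For a compact geodesic space $(X,d)$, $\mathcal{P}(X)$ is the set of Borel probability measures on $X$ with the Wasserstein distance $d^W(\mu,\nu)^2=\inf_{\pi}\int_{X\times X}d(x,y)^2\,d\pi(x,y)$, the infimum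 being over Borel probability measures $\pi$ on $X\times X$ with marginals $\mu$ and $\nu$. A geodesic in $\mathcal{P}(X)$ from $\mu_0$ to $\mu_1$ is a curve $(\mu_t)_{t\in[0,1]}$ with $d^W(\mu_t,\mu_{t'})=|t-t'|\,d^W(\mu_0,\mu_1)$. For $m\in\mathcal{P}(X)$, $\mathrm{Ent}(\mu|m)=\int_X\rho\log\rho\,dm$ if $\mu\ll m$ with $\mu=\rho m$, and $+\infty$ otherwise. $(X,d,m)$ has generalized $\mathrm{Ric}\ge K$ (equivalently, $\mathrm{Ent}(\cdot|m)$ is weakly a.c. $K$-displacement convex) if for any $\mu_0,\mu_1\in\mathcal{P}(X)$ with $\mu_0,\mu_1\ll m$ there exists a geodesic $(\mu_t)$ in $\mathcal{P}(X)$ from $\mu_0$ to $\mu_1$ such that for all $t\in[0,1]$ $$\mathrm{Ent}(\mu_t|m)\le t\,\mathrm{Ent}(\mu_1|m)+(1-t)\,\mathrm{Ent}(\mu_0|m)-\frac K2t(1-t)\,d^W(\mu_0,\mu_1)^2 .$$ *)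

theory Defs
  imports "HOL-Probability.Probability"
begin

definition borel_of_topology :: "'a topology \<Rightarrow> 'a measure" where
  "borel_of_topology T = sigma (topspace T) {U. openin T U}"

definition borel_prob_measures :: "'a topology \<Rightarrow> 'a measure set" where
  "borel_prob_measures T = {\<mu>. prob_space \<mu> \<and> sets \<mu> = sets (borel_of_topology T)}"

definition couplings ::
  "'a topology \<Rightarrow> 'a measure \<Rightarrow> 'a measure \<Rightarrow> ('a \<times> 'a) measure set" where
  "couplings T \<mu> \<nu> = {\<pi> \<in> borel_prob_measures (prod_topology T T).
     distr \<pi> (borel_of_topology T) fst = \<mu> \<and> distr \<pi> (borel_of_topology T) snd = \<nu>}"

text \<open>The definition is meant for compact spaces: there the distance is bounded,
  so the infimum is finite and \<open>enn2real\<close> loses nothing.\<close>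

definition wasserstein_dist ::
  "'a set \<Rightarrow> ('a \<Rightarrow> 'a \<Rightarrow> real) \<Rightarrow> 'a measure \<Rightarrow> 'a measure \<Rightarrow> real" where
  "wasserstein_dist X d \<mu> \<nu> =
     sqrt (enn2real (INF \<pi> \<in> couplings (Metric_space.mtopology X d) \<mu> \<nu>.
       (\<integral>\<^sup>+ p. ennreal ((d (fst p) (snd p))\<^sup>2) \<partial>\<pi>)))"

definition wasserstein_geodesic ::
  "'a set \<Rightarrow> ('a \<Rightarrow> 'a \<Rightarrow> real) \<Rightarrow> (real \<Rightarrow> 'a measure) \<Rightarrow> 'a measure \<Rightarrow> 'a measure \<Rightarrow> bool"
where
  "wasserstein_geodesic X d \<mu> \<mu>0 \<mu>1 \<longleftrightarrow>
     \<mu> 0 = \<mu>0 \<and> \<mu> 1 = \<mu>1 \<and>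
     (\<forall>t\<in>{0..1}. \<mu> t \<in> borel_prob_measures (Metric_space.mtopology X d)) \<and>
     (\<forall>s\<in>{0..1}. \<forall>t\<in>{0..1}.
        wasserstein_dist X d (\<mu> s) (\<mu> t) = \<bar>s - t\<bar> * wasserstein_dist X d \<mu>0 \<mu>1)"

text \<open>The integral of \<open>\<rho> log \<rho>\<close> may be infinite, so it is taken as the difference of the integrals
  of its positive and negative parts. As \<open>\<rho> log \<rho>\<close> is bounded below, the second one is finite
  whenever \<open>m\<close> is. At \<open>\<rho> = 0\<close> the integrand is \<open>0 * ln 0 = 0\<close>.\<close>

definition relative_entropy :: "'a measure \<Rightarrow> 'a measure \<Rightarrow> ereal" where
  "relative_entropy \<mu> m =
    (if absolutely_continuous m \<mu> then
       (let \<rho> = (\<lambda>x. enn2real (RN_deriv m \<mu> x)) in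
          enn2ereal (\<integral>\<^sup>+ x. ennreal (\<rho> x * ln (\<rho> x)) \<partial>m)
        - enn2ereal (\<integral>\<^sup>+ x. ennreal (- (\<rho> x * ln (\<rho> x))) \<partial>m))
     else \<infinity>)"

definition generalized_Ricci_ge ::
  "'a set \<Rightarrow> ('a \<Rightarrow> 'a \<Rightarrow> real) \<Rightarrow> 'a measure \<Rightarrow> real \<Rightarrow> bool" where
  "generalized_Ricci_ge X d m K \<longleftrightarrow>
     (\<forall>\<mu>0 \<in> borel_prob_measures (Metric_space.mtopology X d).
      \<forall>\<mu>1 \<in> borel_prob_measures (Metric_space.mtopology X d).
        absolutely_continuous m \<mu>0 \<longrightarrow> absolutely_continuous m \<mu>1 \<longrightarrow>
        (\<exists>\<mu>. wasserstein_geodesic X d \<mu> \<mu>0 \<mu>1 \<and>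
           (\<forall>t\<in>{0..1}. relative_entropy (\<mu> t) m
              \<le> ereal t * relative_entropy \<mu>1 m + ereal (1 - t) * relative_entropy \<mu>0 m
                - ereal (K / 2 * t * (1 - t) * (wasserstein_dist X d \<mu>0 \<mu>1)\<^sup>2))))"

text \<open>Each class in \<open>L\<^sup>2([0,1])\<close> is represented by its right continuous member, made unique as a
  function on the whole line by \<open>extensional\<close>.\<close>

definition G0 :: "(real \<Rightarrow> real) set" where
  "G0 = {g \<in> {0..1} \<rightarrow>\<^sub>E {0..1}.
           mono_on {0..1} g \<and> (\<forall>t\<in>{0..<1}. continuous (at_right t) g) \<and> g 1 = 1}"

definition L2_dist :: "(real \<Rightarrow> real) \<Rightarrow> (real \<Rightarrow> real) \<Rightarrow> real" where
  "L2_dist f g = sqrt (LBINT t:{0..1}. (f t - g t)\<^sup>2)"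

text \<open>A point of \<open>[0,1]\<^sup>N\<close> is an extensional function on \<open>{1..N}\<close>; the following adds
  the coordinates \<open>x\<^sub>0 = 0\<close> and \<open>x\<^sub>N\<^sub>+\<^sub>1 = 1\<close>.\<close>

definition with_endpoints :: "nat \<Rightarrow> (nat \<Rightarrow> real) \<Rightarrow> nat \<Rightarrow> real" where
  "with_endpoints N x = x(0 := 0, Suc N := 1)"

definition ordered_simplex :: "nat \<Rightarrow> (nat \<Rightarrow> real) set" where
  "ordered_simplex N = {x \<in> {1..N} \<rightarrow>\<^sub>E {0..1}.
     \<forall>i\<le>N. with_endpoints N x i < with_endpoints N x (Suc i)}"

definition entropic_measure :: "real \<Rightarrow> (real \<Rightarrow> real) measure \<Rightarrow> bool" where
  "entropic_measure \<beta> Q \<longleftrightarrow>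
     Q \<in> borel_prob_measures (Metric_space.mtopology G0 L2_dist) \<and>
     (\<forall>N (t :: nat \<Rightarrow> real) (u :: (nat \<Rightarrow> real) \<Rightarrow> real).
        t 0 = 0 \<longrightarrow> t (Suc N) = 1 \<longrightarrow> (\<forall>i\<le>N. t i < t (Suc i)) \<longrightarrow>
        u \<in> borel_measurable (\<Pi>\<^sub>M i\<in>{1..N}. restrict_space borel {0..1}) \<longrightarrow>
        bounded (u ` ({1..N} \<rightarrow>\<^sub>E {0..1})) \<longrightarrow>
        (\<integral>g. u (\<lambda>i\<in>{1..N}. g (t i)) \<partial>Q) =
          Gamma \<beta> / (\<Prod>i=0..N. Gamma (\<beta> * (t (Suc i) - t i))) *
          (LINT x:ordered_simplex N|(\<Pi>\<^sub>M i\<in>{1..N}. lborel).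
             u x * (\<Prod>i=0..N. (with_endpoints N x (Suc i) - with_endpoints N x i)
                               powr (\<beta> * (t (Suc i) - t i) - 1))))"

end

theory Submission
  imports Defs
begin

text \<open>The curvature bound would give a Brunn-Minkowski inequality: if \<open>\<mu>\<^sub>0\<close>, \<open>\<mu>\<^sub>1\<close> are the normalized
  restrictions of \<open>Q\<close> to sets \<open>A\<^sub>0\<close>, \<open>A\<^sub>1\<close>, then \<open>\<mu>\<^sub>1\<^sub>/\<^sub>2\<close> lives on the midpoints of \<open>A\<^sub>0\<close> and \<open>A\<^sub>1\<close>, and Jensen's
  inequality bounds the \<open>Q\<close>-measure of any neighbourhood \<open>H\<close> of the midpoint set from below by a
  constant times \<open>sqrt (Q(A\<^sub>0) Q(A\<^sub>1))\<close>. Fix small times \<open>p < m < q\<close>. The law of \<open>g(q)\<close> has a density of order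
  \<open>x powr (\<beta> q - 1)\<close> near \<open>0\<close>, so that \<open>A\<^sub>0 = {g(q) \<approx> 0}\<close> up to \<open>\<epsilon>\<close> has mass of order \<open>\<epsilon> powr (\<beta> q)\<close>;
  \<open>A\<^sub>1 = {g \<approx> 1/2 on [p, q]}\<close> has mass of order \<open>\<epsilon> powr (1 + \<beta> (q - p))\<close>; but \<open>H = {g(m) \<approx> 1/4}\<close>
  has mass of order \<open>\<epsilon>\<close>. As \<open>\<beta> q + \<beta> (q - p) < 1\<close>, this fails for small \<open>\<epsilon>\<close>.\<close>

section \<open>Couplings and Wasserstein midpoints\<close>

text \<open>The entropic measure is the law of a normalized gamma process, which moves by jumps
  only: moving by at most \<epsilon> during a time span of length l costs
  \<open>\<epsilon> powr (\<beta> * l)\<close>, nearly nothing for short spans, while prescribing a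
  value inside (0, 1) up to \<epsilon> costs \<epsilon>. Averaging a cheap cluster at the boundary
  value 0 with a flat piece at 1/2 leads to a set that pays the full price \<epsilon>. The curvature
  term only changes the constant factor, since the diameter is at most 1. Two obstacles shape the
  proof. The curvature bound concerns absolutely continuous measures, so both ends are sets of
  positive mass and of width \<epsilon>, and their midpoints fill a window of the same order. A
  geodesic in the Wasserstein space is given by its distances alone, with no lift to geodesics of
  \<open>G0\<close>; that its middle measure sits near midpoints is derived from almost optimal
  couplings and a uniform gap in the parallelogram identity.\<close>

lemma space_borel_of_topology [simp]: "space (borel_of_topology T) = topspace T"
  unfolding borel_of_topology_def
  by (rule space_measure_of) (auto dest: openin_subset)

lemma sets_borel_of_topology:
  "sets (borel_of_topology T) = sigma_sets (topspace T) {U. openin T U}"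
  unfolding borel_of_topology_def
  by (rule sets_measure_of) (auto dest: openin_subset)

lemma borel_of_topology_open: "openin T U \<Longrightarrow> U \<in> sets (borel_of_topology T)"
  by (auto simp: sets_borel_of_topology)

lemma continuous_map_measurable:
  assumes "continuous_map S T f"
  shows "f \<in> borel_of_topology S \<rightarrow>\<^sub>M borel_of_topology T"
proof (rule measurable_sigma_sets[OF sets_borel_of_topology])
  show "{U. openin T U} \<subseteq> Pow (topspace T)"
    by (auto dest: openin_subset)
  show "f \<in> space (borel_of_topology S) \<rightarrow> topspace T"
    using assms by (auto simp: continuous_map_def)
  show "f -` U \<inter> space (borel_of_topology S) \<in> sets (borel_of_topology S)"
    if "U \<in> {U. openin T U}" for U
  proof -
    have "f -` U \<inter> space (borel_of_topology S) = {x \<in> topspace S. f x \<in> U}" by auto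
    then show ?thesis
      using that assms by (auto simp: continuous_map_def intro!: borel_of_topology_open)
  qed
qed

text \<open>The cells replace a disintegration: two couplings with a common marginal are glued
  cell by cell.\<close>

locale bounded_cell_metric = Metric_space M d for M :: "'a set" and d :: "'a \<Rightarrow> 'a \<Rightarrow> real" +
  assumes bounded: "\<And>x y. x \<in> M \<Longrightarrow> y \<in> M \<Longrightarrow> d x y \<le> 1"
    and cells: "\<And>r. r > 0 \<Longrightarrow> \<exists>\<kappa> :: 'a \<Rightarrow> nat.
      \<kappa> \<in> borel_of_topology mtopology \<rightarrow>\<^sub>M count_space UNIV \<and>
      (\<forall>x\<in>M. \<forall>y\<in>M. \<kappa> x = \<kappa> y \<longrightarrow> d x y \<le> r)"
begin

section \<open>Borel sets of the product space\<close>

abbreviation "B \<equiv> borel_of_topology mtopology"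

text \<open>Couplings live on the Borel sets of the product topology, while all integrals below use
  the product sigma-algebra. For the nontrivial inclusion the cells of scale
  \<open>1 / real (Suc n)\<close> play the part of a countable base: an open set is the union of
  those products of two equally fine cells that it contains, and there are only countably many of
  them.\<close>

lemma sets_borel_prod:
  "sets (borel_of_topology (prod_topology mtopology mtopology)) = sets (B \<Otimes>\<^sub>M B)"
proof
  let ?P = "borel_of_topology (prod_topology mtopology mtopology)"
  have m1: "fst \<in> ?P \<rightarrow>\<^sub>M B" and m2: "snd \<in> ?P \<rightarrow>\<^sub>M B"
    by (auto intro!: continuous_map_measurable continuous_map_fst continuous_map_snd)
  have "(\<lambda>p. (fst p, snd p)) \<in> ?P \<rightarrow>\<^sub>M B \<Otimes>\<^sub>M B"
    using m1 m2 by measurable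
  then have id: "(\<lambda>p. p) \<in> ?P \<rightarrow>\<^sub>M B \<Otimes>\<^sub>M B" by simp
  show "sets (B \<Otimes>\<^sub>M B) \<subseteq> sets ?P"
  proof
    fix A assume A: "A \<in> sets (B \<Otimes>\<^sub>M B)"
    have "A \<subseteq> space ?P" using sets.sets_into_space[OF A] by (auto simp: space_pair_measure)
    then show "A \<in> sets ?P"
      using measurable_sets[OF id A] by (simp add: Int_absorb2)
  qed
  obtain \<kappa> :: "nat \<Rightarrow> 'a \<Rightarrow> nat" where
    k_meas: "\<And>n. \<kappa> n \<in> B \<rightarrow>\<^sub>M count_space UNIV" and
    k_diam: "\<And>n x y. x \<in> M \<Longrightarrow> y \<in> M \<Longrightarrow> \<kappa> n x = \<kappa> n y \<Longrightarrow> d x y \<le> 1 / real (Suc n)"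
    using cells[of "1 / real (Suc n)" for n] by (metis of_nat_0_less_iff zero_less_Suc zero_less_divide_1_iff)
  define C where "C n k = \<kappa> n -` {k} \<inter> M" for n k
  have C[measurable]: "C n k \<in> sets B" for n k
    using measurable_sets[OF k_meas, of "{k}" n] by (simp add: C_def)
  have "U \<in> sets (B \<Otimes>\<^sub>M B)" if U: "openin (prod_topology mtopology mtopology) U" for U
  proof -
    define J where "J = {(n, k, l). C n k \<times> C n l \<subseteq> U}"
    have "U = (\<Union>(n, k, l)\<in>J. C n k \<times> C n l)"
    proof
      show "(\<Union>(n, k, l)\<in>J. C n k \<times> C n l) \<subseteq> U" by (auto simp: J_def)
      show "U \<subseteq> (\<Union>(n, k, l)\<in>J. C n k \<times> C n l)"
      proof clarify
        fix x z assume xz: "(x, z) \<in> U"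
        then obtain V W where V: "openin mtopology V" "x \<in> V" and W: "openin mtopology W" "z \<in> W"
          and VW: "V \<times> W \<subseteq> U"
          using U unfolding openin_prod_topology_alt by meson
        have xM: "x \<in> M" "z \<in> M"
          using V W openin_subset by fastforce+
        obtain r1 r2 where r: "r1 > 0" "mball x r1 \<subseteq> V" "r2 > 0" "mball z r2 \<subseteq> W"
          using V W by (meson openin_mtopology)
        obtain n where n: "1 / real (Suc n) < min r1 r2"
          using r by (metis inverse_eq_divide min_less_iff_conj reals_Archimedean)
        have "C n (\<kappa> n x) \<subseteq> V"
        proof
          fix y assume y: "y \<in> C n (\<kappa> n x)"
          then have "d x y \<le> 1 / real (Suc n)" using k_diam[of x y n] xM by (auto simp: C_def)
          then have "y \<in> mball x r1" using n xM y by (auto simp: C_def)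
          then show "y \<in> V" using r by auto
        qed
        moreover have "C n (\<kappa> n z) \<subseteq> W"
        proof
          fix y assume y: "y \<in> C n (\<kappa> n z)"
          then have "d z y \<le> 1 / real (Suc n)" using k_diam[of z y n] xM by (auto simp: C_def)
          then have "y \<in> mball z r2" using n xM y by (auto simp: C_def)
          then show "y \<in> W" using r by auto
        qed
        ultimately have "(n, \<kappa> n x, \<kappa> n z) \<in> J" using VW by (auto simp: J_def)
        then show "(x, z) \<in> (\<Union>(n, k, l)\<in>J. C n k \<times> C n l)"
          using xM by (force simp: C_def)
      qed
    qed
    moreover have "(\<Union>(n, k, l)\<in>J. C n k \<times> C n l) \<in> sets (B \<Otimes>\<^sub>M B)"
      by (rule sets.countable_UN') (auto intro!: C pair_measureI)
    ultimately show ?thesis by simp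
  qed
  then show "sets ?P \<subseteq> sets (B \<Otimes>\<^sub>M B)"
    unfolding sets_borel_of_topology[of "prod_topology _ _"]
    using sets.sigma_sets_subset[of "{U. openin (prod_topology mtopology mtopology) U}" "B \<Otimes>\<^sub>M B"]
    by (auto simp: space_pair_measure)
qed

lemma measurable_dist: "(\<lambda>p. d (fst p) (snd p)) \<in> borel_measurable (B \<Otimes>\<^sub>M B)"
proof -
  have "continuous_map (prod_topology mtopology mtopology) euclidean (\<lambda>p. d (fst p) (snd p))"
  proof -
    show ?thesis
      using continuous_map_metric[of "metric (M, d)"] by (simp add: case_prod_beta' mtopology_of)
  qed
  then have "(\<lambda>p. d (fst p) (snd p)) \<in>
      borel_of_topology (prod_topology mtopology mtopology) \<rightarrow>\<^sub>M borel_of_topology euclidean"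
    by (rule continuous_map_measurable)
  moreover have "sets (borel_of_topology (euclidean :: real topology)) = sets borel"
    unfolding sets_borel_of_topology borel_def by (simp add: sets_measure_of)
  ultimately show ?thesis
    using measurable_cong_sets[OF sets_borel_prod] by (metis measurable_cong_sets)
qed

section \<open>Couplings and their gluing\<close>

lemma couplingsD:
  assumes "\<pi> \<in> couplings mtopology \<mu> \<nu>"
  shows "prob_space \<pi>" "sets \<pi> = sets (B \<Otimes>\<^sub>M B)" "distr \<pi> B fst = \<mu>" "distr \<pi> B snd = \<nu>"
  using assms by (auto simp: couplings_def borel_prob_measures_def sets_borel_prod)

lemma couplingsI:
  assumes "prob_space \<pi>" "sets \<pi> = sets (B \<Otimes>\<^sub>M B)" "distr \<pi> B fst = \<mu>" "distr \<pi> B snd = \<nu>"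
  shows "\<pi> \<in> couplings mtopology \<mu> \<nu>"
  using assms by (auto simp: couplings_def borel_prob_measures_def sets_borel_prod)

lemma coupling_marginals:
  assumes "\<pi> \<in> couplings mtopology \<mu> \<nu>" and A: "A \<in> sets B"
  shows "emeasure \<mu> A = emeasure \<pi> {p \<in> space \<pi>. fst p \<in> A}"
    and "emeasure \<nu> A = emeasure \<pi> {p \<in> space \<pi>. snd p \<in> A}"
proof -
  note c = couplingsD[OF assms(1)]
  have m: "fst \<in> \<pi> \<rightarrow>\<^sub>M B" "snd \<in> \<pi> \<rightarrow>\<^sub>M B"
    using c(2) by (simp_all cong: measurable_cong_sets)
  show "emeasure \<mu> A = emeasure \<pi> {p \<in> space \<pi>. fst p \<in> A}"
    using emeasure_distr[OF m(1) A] c(3) by (simp add: vimage_def Int_def conj_commute)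
  show "emeasure \<nu> A = emeasure \<pi> {p \<in> space \<pi>. snd p \<in> A}"
    using emeasure_distr[OF m(2) A] c(4) by (simp add: vimage_def Int_def conj_commute)
qed

text \<open>The two couplings are made independent given the cell of the middle point: the density
  of \<open>P\<close> with respect to \<open>\<pi>1 \<Otimes>\<^sub>M \<pi>2\<close> is the inverse
  of the \<nu>-mass of the cell if both middle points share it, and 0 otherwise. The marginals come
  out exactly; the price is that the two middle points agree only up to \<open>r\<close>.\<close>

lemma glue_couplings:
  assumes p1: "\<pi>1 \<in> couplings mtopology \<mu> \<nu>" and p2: "\<pi>2 \<in> couplings mtopology \<nu> \<xi>" and r: "r > 0"
  obtains P where "sets P = sets ((B \<Otimes>\<^sub>M B) \<Otimes>\<^sub>M (B \<Otimes>\<^sub>M B))"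
    "distr P (B \<Otimes>\<^sub>M B) fst = \<pi>1" "distr P (B \<Otimes>\<^sub>M B) snd = \<pi>2"
    "AE p in P. d (snd (fst p)) (fst (snd p)) \<le> r"
proof -
  obtain \<kappa> :: "'a \<Rightarrow> nat" where k[measurable]: "\<kappa> \<in> B \<rightarrow>\<^sub>M count_space UNIV"
    and kr: "\<And>x y. x \<in> M \<Longrightarrow> y \<in> M \<Longrightarrow> \<kappa> x = \<kappa> y \<Longrightarrow> d x y \<le> r"
    using cells[OF r] by blast
  interpret p1: prob_space \<pi>1 using couplingsD(1)[OF p1] .
  interpret p2: prob_space \<pi>2 using couplingsD(1)[OF p2] .
  interpret pp: pair_sigma_finite \<pi>1 \<pi>2 ..
  note [measurable_cong] = couplingsD(2)[OF p1] couplingsD(2)[OF p2]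
  have proj: "fst \<in> \<pi>1 \<rightarrow>\<^sub>M B" "snd \<in> \<pi>1 \<rightarrow>\<^sub>M B" "fst \<in> \<pi>2 \<rightarrow>\<^sub>M B" "snd \<in> \<pi>2 \<rightarrow>\<^sub>M B"
    using couplingsD(2)[OF p1] couplingsD(2)[OF p2] by (simp_all cong: measurable_cong_sets)
  have sp: "space \<pi>1 = M \<times> M" "space \<pi>2 = M \<times> M"
    using sets_eq_imp_space_eq[OF couplingsD(2)[OF p1]] sets_eq_imp_space_eq[OF couplingsD(2)[OF p2]]
    by (auto simp: space_pair_measure)
  \<comment> \<open>Both couplings give cell \<open>k\<close> the mass \<open>m k\<close>, as \<nu>
    is the second marginal of one and the first marginal of the other. Hence a single weight
    normalizes both sides.\<close>
  define m where "m k = emeasure \<nu> {x \<in> space B. \<kappa> x = k}" for k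
  have cell[measurable]: "{x \<in> space B. \<kappa> x = k} \<in> sets B" for k
    by measurable
  have m1: "m k = emeasure \<pi>1 {p \<in> space \<pi>1. \<kappa> (snd p) = k}" for k
  proof -
    have "{p \<in> space \<pi>1. snd p \<in> {x \<in> space B. \<kappa> x = k}} = {p \<in> space \<pi>1. \<kappa> (snd p) = k}"
      by (auto simp: sp)
    then show ?thesis using coupling_marginals(2)[OF p1 cell] unfolding m_def by simp
  qed
  have m2: "m k = emeasure \<pi>2 {p \<in> space \<pi>2. \<kappa> (fst p) = k}" for k
  proof -
    have "{p \<in> space \<pi>2. fst p \<in> {x \<in> space B. \<kappa> x = k}} = {p \<in> space \<pi>2. \<kappa> (fst p) = k}"
      by (auto simp: sp)
    then show ?thesis using coupling_marginals(1)[OF p2 cell] unfolding m_def by simp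
  qed
  have [measurable]: "{p \<in> space \<pi>1. \<kappa> (snd p) = k} \<in> sets \<pi>1" for k
  proof -
    have "{p \<in> space \<pi>1. \<kappa> (snd p) = k} = snd -` {x \<in> space B. \<kappa> x = k} \<inter> space \<pi>1"
      by (auto simp: sp)
    then show ?thesis using measurable_sets[OF proj(2) cell[of k]] by simp
  qed
  \<comment> \<open>The inverse of a zero mass is infinite, so the normalization fails on null
    cells. They are countably many, and almost surely the middle point avoids them all.\<close>
  have ae1: "AE p in \<pi>1. m (\<kappa> (snd p)) \<noteq> 0"
  proof -
    have "AE p in \<pi>1. m k = 0 \<longrightarrow> \<kappa> (snd p) \<noteq> k" for k
      using m1[of k] by (cases "m k = 0") (auto intro!: AE_I[where N="{p \<in> space \<pi>1. \<kappa> (snd p) = k}"])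
    then have "AE p in \<pi>1. \<forall>k. m k = 0 \<longrightarrow> \<kappa> (snd p) \<noteq> k"
      by (simp add: AE_all_countable)
    then show ?thesis by eventually_elim auto
  qed
  have [measurable]: "{p \<in> space \<pi>2. \<kappa> (fst p) = k} \<in> sets \<pi>2" for k
  proof -
    have "{p \<in> space \<pi>2. \<kappa> (fst p) = k} = fst -` {x \<in> space B. \<kappa> x = k} \<inter> space \<pi>2"
      by (auto simp: sp)
    then show ?thesis using measurable_sets[OF proj(3) cell[of k]] by simp
  qed
  have ae2: "AE p in \<pi>2. m (\<kappa> (fst p)) \<noteq> 0"
  proof -
    have "AE p in \<pi>2. m k = 0 \<longrightarrow> \<kappa> (fst p) \<noteq> k" for k
      using m2[of k] by (cases "m k = 0") (auto intro!: AE_I[where N="{p \<in> space \<pi>2. \<kappa> (fst p) = k}"])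
    then have "AE p in \<pi>2. \<forall>k. m k = 0 \<longrightarrow> \<kappa> (fst p) \<noteq> k"
      by (simp add: AE_all_countable)
    then show ?thesis by eventually_elim auto
  qed
  have fin: "m k \<noteq> \<top>" for k unfolding m1 by simp
  have inv: "inverse (m k) * m k = 1" if "m k \<noteq> 0" for k
    using that fin[of k] ennreal_divide_self[of "m k"] by (simp add: divide_ennreal_def mult.commute less_top)
  define w where "w p = (if \<kappa> (snd (fst p)) = \<kappa> (fst (snd p)) then inverse (m (\<kappa> (snd (fst p)))) else 0)"
    for p :: "('a \<times> 'a) \<times> ('a \<times> 'a)"
  have w[measurable]: "w \<in> borel_measurable (\<pi>1 \<Otimes>\<^sub>M \<pi>2)"
  proof -
    have k1: "(\<lambda>p. \<kappa> (snd (fst p))) \<in> \<pi>1 \<Otimes>\<^sub>M \<pi>2 \<rightarrow>\<^sub>M count_space UNIV"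
      and k2: "(\<lambda>p. \<kappa> (fst (snd p))) \<in> \<pi>1 \<Otimes>\<^sub>M \<pi>2 \<rightarrow>\<^sub>M count_space UNIV"
      using measurable_compose[OF measurable_fst measurable_compose[OF proj(2) k]]
        measurable_compose[OF measurable_snd measurable_compose[OF proj(3) k]] by simp_all
    have m: "(\<lambda>p. m (\<kappa> (snd (fst p)))) \<in> borel_measurable (\<pi>1 \<Otimes>\<^sub>M \<pi>2)"
      by (rule measurable_compose[OF k1]) simp
    have "{p \<in> space (\<pi>1 \<Otimes>\<^sub>M \<pi>2). real (\<kappa> (snd (fst p))) = real (\<kappa> (fst (snd p)))}
        \<in> sets (\<pi>1 \<Otimes>\<^sub>M \<pi>2)"
      by (rule borel_measurable_eq)
        (use measurable_compose[OF k1, of real borel] measurable_compose[OF k2, of real borel] in auto)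
    then show ?thesis
      unfolding w_def using m by (intro measurable_If borel_measurable_inverse_ennreal) auto
  qed
  define P where "P = density (\<pi>1 \<Otimes>\<^sub>M \<pi>2) w"
  have setsP: "sets P = sets ((B \<Otimes>\<^sub>M B) \<Otimes>\<^sub>M (B \<Otimes>\<^sub>M B))"
    unfolding P_def using couplingsD(2)[OF p1] couplingsD(2)[OF p2] by (simp cong: sets_pair_measure_cong)
  have mfst: "fst \<in> P \<rightarrow>\<^sub>M B \<Otimes>\<^sub>M B" and msnd: "snd \<in> P \<rightarrow>\<^sub>M B \<Otimes>\<^sub>M B"
    using setsP by (simp_all cong: measurable_cong_sets)
  have "distr P (B \<Otimes>\<^sub>M B) fst = \<pi>1"
  proof (rule measure_eqI)
    show "sets (distr P (B \<Otimes>\<^sub>M B) fst) = sets \<pi>1" using couplingsD(2)[OF p1] by simp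
    fix A assume "A \<in> sets (distr P (B \<Otimes>\<^sub>M B) fst)"
    then have A[measurable]: "A \<in> sets (B \<Otimes>\<^sub>M B)" by simp
    have "emeasure (distr P (B \<Otimes>\<^sub>M B) fst) A = emeasure P (fst -` A \<inter> space P)"
      using mfst by (simp add: emeasure_distr)
    also have "\<dots> = (\<integral>\<^sup>+p. w p * indicator (fst -` A \<inter> space P) p \<partial>(\<pi>1 \<Otimes>\<^sub>M \<pi>2))"
      unfolding P_def by (rule emeasure_density) (use measurable_sets[OF mfst A] in \<open>auto simp: P_def\<close>)
    also have "\<dots> = (\<integral>\<^sup>+p. w p * indicator A (fst p) \<partial>(\<pi>1 \<Otimes>\<^sub>M \<pi>2))"
      by (intro nn_integral_cong) (auto simp: P_def indicator_def)
    also have "\<dots> = (\<integral>\<^sup>+x. (\<integral>\<^sup>+y. w (x, y) * indicator A x \<partial>\<pi>2) \<partial>\<pi>1)"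
      by (subst p2.nn_integral_fst[symmetric]) auto
    \<comment> \<open>Integrating out the second pair leaves the inverse mass of a cell times that
      mass, which is 1.\<close>
    also have "\<dots> = (\<integral>\<^sup>+x. indicator A x \<partial>\<pi>1)"
    proof (rule nn_integral_cong_AE, use ae1 AE_space in eventually_elim)
      case (elim x)
      have "(\<integral>\<^sup>+y. w (x, y) * indicator A x \<partial>\<pi>2)
          = (\<integral>\<^sup>+y. (indicator A x * inverse (m (\<kappa> (snd x)))) * indicator {p \<in> space \<pi>2. \<kappa> (fst p) = \<kappa> (snd x)} y \<partial>\<pi>2)"
        by (intro nn_integral_cong) (auto simp: w_def indicator_def)
      also have "\<dots> = indicator A x * inverse (m (\<kappa> (snd x))) * m (\<kappa> (snd x))"
        unfolding m2 by (subst nn_integral_cmult_indicator) auto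
      finally show ?case using inv[OF elim(1)] by (simp add: mult.assoc)
    qed
    finally show "emeasure (distr P (B \<Otimes>\<^sub>M B) fst) A = emeasure \<pi>1 A" by simp
  qed
  moreover have "distr P (B \<Otimes>\<^sub>M B) snd = \<pi>2"
  proof (rule measure_eqI)
    show "sets (distr P (B \<Otimes>\<^sub>M B) snd) = sets \<pi>2" using couplingsD(2)[OF p2] by simp
    fix A assume "A \<in> sets (distr P (B \<Otimes>\<^sub>M B) snd)"
    then have A[measurable]: "A \<in> sets (B \<Otimes>\<^sub>M B)" by simp
    have "emeasure (distr P (B \<Otimes>\<^sub>M B) snd) A = emeasure P (snd -` A \<inter> space P)"
      using msnd by (simp add: emeasure_distr)
    also have "\<dots> = (\<integral>\<^sup>+p. w p * indicator (snd -` A \<inter> space P) p \<partial>(\<pi>1 \<Otimes>\<^sub>M \<pi>2))"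
      unfolding P_def by (rule emeasure_density) (use measurable_sets[OF msnd A] in \<open>auto simp: P_def\<close>)
    also have "\<dots> = (\<integral>\<^sup>+p. w p * indicator A (snd p) \<partial>(\<pi>1 \<Otimes>\<^sub>M \<pi>2))"
      by (intro nn_integral_cong) (auto simp: P_def indicator_def)
    also have "\<dots> = (\<integral>\<^sup>+y. (\<integral>\<^sup>+x. w (x, y) * indicator A y \<partial>\<pi>1) \<partial>\<pi>2)"
      by (subst pp.nn_integral_snd[symmetric]) auto
    also have "\<dots> = (\<integral>\<^sup>+y. indicator A y \<partial>\<pi>2)"
    proof (rule nn_integral_cong_AE, use ae2 AE_space in eventually_elim)
      case (elim y)
      have "(\<integral>\<^sup>+x. w (x, y) * indicator A y \<partial>\<pi>1)
          = (\<integral>\<^sup>+x. (indicator A y * inverse (m (\<kappa> (fst y)))) * indicator {p \<in> space \<pi>1. \<kappa> (snd p) = \<kappa> (fst y)} x \<partial>\<pi>1)"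
        by (intro nn_integral_cong) (auto simp: w_def indicator_def)
      also have "\<dots> = indicator A y * inverse (m (\<kappa> (fst y))) * m (\<kappa> (fst y))"
        unfolding m1 by (subst nn_integral_cmult_indicator) auto
      finally show ?case using inv[OF elim(1)] by (simp add: mult.assoc)
    qed
    finally show "emeasure (distr P (B \<Otimes>\<^sub>M B) snd) A = emeasure \<pi>2 A" by simp
  qed
  moreover have "AE p in P. d (snd (fst p)) (fst (snd p)) \<le> r"
    unfolding P_def using w
  proof (subst AE_density, simp, intro AE_I2 impI)
    fix p assume "p \<in> space (\<pi>1 \<Otimes>\<^sub>M \<pi>2)" "0 < w p"
    then show "d (snd (fst p)) (fst (snd p)) \<le> r"
      by (auto simp: space_pair_measure sp w_def intro!: kr split: if_splits)
  qed
  ultimately show thesis using that setsP by blast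
qed

section \<open>Transport cost and Wasserstein distance\<close>

lemma dist_sq_le_1: "x \<in> M \<Longrightarrow> y \<in> M \<Longrightarrow> (d x y)\<^sup>2 \<le> 1"
  using bounded[of x y] nonneg[of x y] by (simp add: power_le_one)

lemma coupling_cost:
  assumes p: "\<pi> \<in> couplings mtopology \<mu> \<nu>"
  shows "(\<integral>\<^sup>+ p. ennreal ((d (fst p) (snd p))\<^sup>2) \<partial>\<pi>) = ennreal (\<integral>p. (d (fst p) (snd p))\<^sup>2 \<partial>\<pi>)"
    and "(\<integral>p. (d (fst p) (snd p))\<^sup>2 \<partial>\<pi>) \<le> 1"
proof -
  interpret prob_space \<pi> using couplingsD(1)[OF p] .
  have sp: "space \<pi> = M \<times> M"
    using sets_eq_imp_space_eq[OF couplingsD(2)[OF p]] by (auto simp: space_pair_measure)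
  have [measurable]: "(\<lambda>p. d (fst p) (snd p)) \<in> borel_measurable \<pi>"
    using measurable_dist couplingsD(2)[OF p] by (simp cong: measurable_cong_sets)
  have int: "integrable \<pi> (\<lambda>p. (d (fst p) (snd p))\<^sup>2)"
    by (rule integrable_const_bound[where B=1]) (auto intro!: AE_I2 simp: sp dist_sq_le_1)
  show "(\<integral>\<^sup>+ p. ennreal ((d (fst p) (snd p))\<^sup>2) \<partial>\<pi>) = ennreal (\<integral>p. (d (fst p) (snd p))\<^sup>2 \<partial>\<pi>)"
    by (rule nn_integral_eq_integral[OF int]) simp
  show "(\<integral>p. (d (fst p) (snd p))\<^sup>2 \<partial>\<pi>) \<le> 1"
    by (rule integral_le_const[OF int]) (auto intro!: AE_I2 simp: sp dist_sq_le_1)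
qed

text \<open>The product coupling keeps the infimum in \<open>wasserstein_dist\<close> finite, so
  that \<open>enn2real\<close> does not collapse it to 0.\<close>

lemma couplings_nonempty:
  assumes "\<mu> \<in> borel_prob_measures mtopology" "\<nu> \<in> borel_prob_measures mtopology"
  shows "\<mu> \<Otimes>\<^sub>M \<nu> \<in> couplings mtopology \<mu> \<nu>"
proof (rule couplingsI)
  have m: "prob_space \<mu>" "sets \<mu> = sets B" and n: "prob_space \<nu>" "sets \<nu> = sets B"
    using assms by (auto simp: borel_prob_measures_def)
  interpret m: prob_space \<mu> by fact
  interpret n: prob_space \<nu> by fact
  interpret mn: pair_prob_space \<mu> \<nu> ..
  show "prob_space (\<mu> \<Otimes>\<^sub>M \<nu>)" by (rule mn.prob_space_axioms)
  show s: "sets (\<mu> \<Otimes>\<^sub>M \<nu>) = sets (B \<Otimes>\<^sub>M B)"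
    using m n by (simp cong: sets_pair_measure_cong)
  have "distr (\<mu> \<Otimes>\<^sub>M \<nu>) B fst = distr (\<mu> \<Otimes>\<^sub>M \<nu>) \<mu> fst"
    by (rule distr_cong) (auto simp: m)
  also have "\<dots> = \<mu>" by (rule n.distr_pair_fst)
  finally show "distr (\<mu> \<Otimes>\<^sub>M \<nu>) B fst = \<mu>" .
  show "distr (\<mu> \<Otimes>\<^sub>M \<nu>) B snd = \<nu>"
  proof (rule measure_eqI)
    fix A assume "A \<in> sets (distr (\<mu> \<Otimes>\<^sub>M \<nu>) B snd)"
    then have A: "A \<in> sets B" by simp
    have "snd -` A \<inter> space (\<mu> \<Otimes>\<^sub>M \<nu>) = space \<mu> \<times> A"
      using sets.sets_into_space[of A \<nu>] A n(2) by (auto simp: space_pair_measure)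
    then show "emeasure (distr (\<mu> \<Otimes>\<^sub>M \<nu>) B snd) A = emeasure \<nu> A"
      using A n(2) s n.emeasure_pair_measure_Times[OF sets.top[of \<mu>], of A]
      by (simp add: emeasure_distr m.emeasure_space_1 cong: measurable_cong_sets)
  qed (simp add: n)
qed

lemma wasserstein_dist_le_cost:
  assumes p: "\<pi> \<in> couplings mtopology \<mu> \<nu>"
  shows "(wasserstein_dist M d \<mu> \<nu>)\<^sup>2 \<le> (\<integral>p. (d (fst p) (snd p))\<^sup>2 \<partial>\<pi>)"
proof -
  let ?I = "INF \<pi> \<in> couplings mtopology \<mu> \<nu>. (\<integral>\<^sup>+ p. ennreal ((d (fst p) (snd p))\<^sup>2) \<partial>\<pi>)"
  have "?I \<le> ennreal (\<integral>p. (d (fst p) (snd p))\<^sup>2 \<partial>\<pi>)"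
    using p by (metis (no_types, lifting) INF_lower coupling_cost(1))
  then have "enn2real ?I \<le> (\<integral>p. (d (fst p) (snd p))\<^sup>2 \<partial>\<pi>)"
    by (intro enn2real_leI) auto
  then show ?thesis by (simp add: wasserstein_dist_def)
qed

lemma wasserstein_dist_bounds:
  assumes "\<mu> \<in> borel_prob_measures mtopology" "\<nu> \<in> borel_prob_measures mtopology"
  shows "(wasserstein_dist M d \<mu> \<nu>)\<^sup>2 \<le> 1"
  using wasserstein_dist_le_cost coupling_cost(2) couplings_nonempty[OF assms] by (meson order_trans)

text \<open>Takes the place of an optimal coupling; the slack \<eta> is made small in
  \<open>midpoint_null\<close>.\<close>

lemma wasserstein_dist_approx:
  assumes "\<mu> \<in> borel_prob_measures mtopology" "\<nu> \<in> borel_prob_measures mtopology" "\<eta> > 0"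
  obtains \<pi> where "\<pi> \<in> couplings mtopology \<mu> \<nu>"
    "(\<integral>p. (d (fst p) (snd p))\<^sup>2 \<partial>\<pi>) < (wasserstein_dist M d \<mu> \<nu>)\<^sup>2 + \<eta>"
proof -
  let ?I = "INF \<pi> \<in> couplings mtopology \<mu> \<nu>. (\<integral>\<^sup>+ p. ennreal ((d (fst p) (snd p))\<^sup>2) \<partial>\<pi>)"
  have "?I \<le> ennreal (\<integral>p. (d (fst p) (snd p))\<^sup>2 \<partial>(\<mu> \<Otimes>\<^sub>M \<nu>))"
    using couplings_nonempty[OF assms(1,2)] by (metis (no_types, lifting) INF_lower coupling_cost(1))
  then have fin: "?I < \<top>"
    using ennreal_less_top le_less_trans by blast
  have "?I < ennreal (enn2real ?I + \<eta>)"
    using fin assms(3) by (cases ?I) (auto simp: ennreal_less_iff simp flip: ennreal_plus)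
  then obtain \<pi> where pi: "\<pi> \<in> couplings mtopology \<mu> \<nu>"
    "(\<integral>\<^sup>+ p. ennreal ((d (fst p) (snd p))\<^sup>2) \<partial>\<pi>) < ennreal (enn2real ?I + \<eta>)"
    by (auto simp: INF_less_iff)
  then have "(\<integral>p. (d (fst p) (snd p))\<^sup>2 \<partial>\<pi>) < enn2real ?I + \<eta>"
    using coupling_cost(1)[OF pi(1)] by (simp add: ennreal_less_iff)
  then show thesis using that pi by (simp add: wasserstein_dist_def)
qed

text \<open>This is the gap inequality of \<open>midpoint_null\<close> with \<open>c = 0\<close>; it
  serves there for middle points outside \<open>S\<close>.\<close>

lemma triangle_sq:
  assumes "x \<in> M" "y \<in> M" "z \<in> M"
  shows "(d x z)\<^sup>2 / 4 \<le> (d x y)\<^sup>2 / 2 + (d y z)\<^sup>2 / 2"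
proof -
  have "(d x z)\<^sup>2 \<le> (d x y + d y z)\<^sup>2"
    using triangle[OF assms] by (intro power_mono) auto
  also have "\<dots> \<le> 2 * (d x y)\<^sup>2 + 2 * (d y z)\<^sup>2"
    using sum_squares_ge_zero[of "d x y - d y z" 0] by (simp add: power2_eq_square algebra_simps)
  finally show ?thesis by simp
qed

text \<open>For nearly optimal couplings to the two ends, the cost of the glued coupling leaves
  no room for the gap \<open>c\<close>.\<close>

lemma midpoint_null:
  assumes bp: "\<mu> \<in> borel_prob_measures mtopology" "\<nu> \<in> borel_prob_measures mtopology"
      "\<xi> \<in> borel_prob_measures mtopology"
    and W1: "wasserstein_dist M d \<mu> \<nu> = wasserstein_dist M d \<mu> \<xi> / 2"
    and W2: "wasserstein_dist M d \<nu> \<xi> = wasserstein_dist M d \<mu> \<xi> / 2"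
    and S: "S \<in> sets B" and A0: "A0 \<in> sets B" "AE x in \<mu>. x \<in> A0" and A1: "A1 \<in> sets B" "AE x in \<xi>. x \<in> A1"
    and c: "c > 0"
    and gap: "\<And>x y z. x \<in> A0 \<Longrightarrow> y \<in> S \<Longrightarrow> z \<in> A1 \<Longrightarrow> (d x z)\<^sup>2 / 4 + c \<le> (d x y)\<^sup>2 / 2 + (d y z)\<^sup>2 / 2"
  shows "emeasure \<nu> S = 0"
proof -
  define W where "W = wasserstein_dist M d \<mu> \<xi>"
  interpret nu: prob_space \<nu> using bp by (simp add: borel_prob_measures_def)
  \<comment> \<open>The slack adds up to \<open>5 / 2 * \<eta>\<close>: half of \<eta> from each
    nearly optimal coupling and \<open>3 * \<eta> / 2\<close> from the mismatch of the two middle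
    points.\<close>
  have key: "c * measure \<nu> S \<le> 3 * \<eta>" if eta: "0 < \<eta>" "\<eta> \<le> 1" for \<eta> :: real
  proof -
    obtain \<pi>1 where p1: "\<pi>1 \<in> couplings mtopology \<mu> \<nu>"
      and c1: "(\<integral>p. (d (fst p) (snd p))\<^sup>2 \<partial>\<pi>1) < (W / 2)\<^sup>2 + \<eta>"
      using wasserstein_dist_approx[OF bp(1,2) eta(1)] by (metis W1 W_def)
    obtain \<pi>2 where p2: "\<pi>2 \<in> couplings mtopology \<nu> \<xi>"
      and c2: "(\<integral>p. (d (fst p) (snd p))\<^sup>2 \<partial>\<pi>2) < (W / 2)\<^sup>2 + \<eta>"
      using wasserstein_dist_approx[OF bp(2,3) eta(1)] by (metis W2 W_def)
    obtain P where P: "sets P = sets ((B \<Otimes>\<^sub>M B) \<Otimes>\<^sub>M (B \<Otimes>\<^sub>M B))"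
      and D1: "distr P (B \<Otimes>\<^sub>M B) fst = \<pi>1" and D2: "distr P (B \<Otimes>\<^sub>M B) snd = \<pi>2"
      and close: "AE p in P. d (snd (fst p)) (fst (snd p)) \<le> \<eta>"
      using glue_couplings[OF p1 p2 eta(1)] by blast
    note [measurable_cong] = P
    note [measurable] = measurable_dist S A0(1) A1(1)
    have f1: "fst \<in> P \<rightarrow>\<^sub>M B \<Otimes>\<^sub>M B" and f2: "snd \<in> P \<rightarrow>\<^sub>M B \<Otimes>\<^sub>M B"
      using P by (simp_all cong: measurable_cong_sets)
    interpret P: prob_space P
      using couplingsD(1)[OF p1] prob_space_distrD[OF f1] unfolding D1 by blast
    have spP: "space P = (M \<times> M) \<times> (M \<times> M)"
      using sets_eq_imp_space_eq[OF P] by (simp add: space_pair_measure)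
    let ?x = "\<lambda>p :: ('a \<times> 'a) \<times> ('a \<times> 'a). fst (fst p)" and ?y = "\<lambda>p :: ('a \<times> 'a) \<times> ('a \<times> 'a). snd (fst p)"
      and ?y' = "\<lambda>p :: ('a \<times> 'a) \<times> ('a \<times> 'a). fst (snd p)" and ?z = "\<lambda>p :: ('a \<times> 'a) \<times> ('a \<times> 'a). snd (snd p)"
    have mx: "?x \<in> P \<rightarrow>\<^sub>M B" "?y \<in> P \<rightarrow>\<^sub>M B" "?y' \<in> P \<rightarrow>\<^sub>M B" "?z \<in> P \<rightarrow>\<^sub>M B"
      by (rule measurable_compose[OF f1] measurable_compose[OF f2], simp)+
    have mxz: "(\<lambda>p. (?x p, ?z p)) \<in> P \<rightarrow>\<^sub>M B \<Otimes>\<^sub>M B" by (rule measurable_Pair[OF mx(1,4)])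
    have dx: "distr P B ?x = \<mu>"
      using distr_distr[of fst "B \<Otimes>\<^sub>M B" B fst P] f1 couplingsD(3)[OF p1] by (simp add: D1 comp_def)
    have dy: "distr P B ?y = \<nu>"
      using distr_distr[of snd "B \<Otimes>\<^sub>M B" B fst P] f1 couplingsD(4)[OF p1] by (simp add: D1 comp_def)
    have dz: "distr P B ?z = \<xi>"
      using distr_distr[of snd "B \<Otimes>\<^sub>M B" B snd P] f2 couplingsD(4)[OF p2] by (simp add: D2 comp_def)
    \<comment> \<open>Forgetting the middle points leaves a coupling of \<mu> and \<xi>, whose cost
      is at least the squared distance. This is the only lower bound on a cost that enters.\<close>
    define \<gamma> where "\<gamma> = distr P (B \<Otimes>\<^sub>M B) (\<lambda>p. (?x p, ?z p))"
    have g: "\<gamma> \<in> couplings mtopology \<mu> \<xi>"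
    proof (rule couplingsI)
      show "prob_space \<gamma>" unfolding \<gamma>_def by (rule P.prob_space_distr[OF mxz])
      show "sets \<gamma> = sets (B \<Otimes>\<^sub>M B)" by (simp add: \<gamma>_def)
      show "distr \<gamma> B fst = \<mu>" "distr \<gamma> B snd = \<xi>"
        unfolding \<gamma>_def by (subst distr_distr; use mxz in \<open>simp add: comp_def dx dz\<close>)+
    qed
    have W: "W\<^sup>2 \<le> (\<integral>p. (d (?x p) (?z p))\<^sup>2 \<partial>P)"
      using wasserstein_dist_le_cost[OF g] mxz unfolding W_def \<gamma>_def by (subst (asm) integral_distr) auto
    have c1': "(\<integral>p. (d (?x p) (?y p))\<^sup>2 \<partial>P) < (W / 2)\<^sup>2 + \<eta>"
      using c1 f1 unfolding D1[symmetric] by (subst (asm) integral_distr) auto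
    have c2': "(\<integral>p. (d (?y' p) (?z p))\<^sup>2 \<partial>P) < (W / 2)\<^sup>2 + \<eta>"
      using c2 f2 unfolding D2[symmetric] by (subst (asm) integral_distr) auto
    have md: "(\<lambda>p. d (f p) (h p)) \<in> borel_measurable P" if "f \<in> P \<rightarrow>\<^sub>M B" "h \<in> P \<rightarrow>\<^sub>M B" for f h
      using measurable_compose[OF measurable_Pair[OF that] measurable_dist] by simp
    have int: "integrable P (\<lambda>p. (d (f p) (h p))\<^sup>2)" if "f \<in> P \<rightarrow>\<^sub>M B" "h \<in> P \<rightarrow>\<^sub>M B" for f h
      by (rule P.integrable_const_bound[where B=1])
        (use md[OF that] measurable_space[OF that(1)] measurable_space[OF that(2)] in
          \<open>auto intro!: AE_I2 dist_sq_le_1 borel_measurable_power\<close>)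
    have Sy: "measure \<nu> S = (\<integral>p. indicator S (?y p) \<partial>P)"
      unfolding dy[symmetric] using mx(2) S integral_distr[OF mx(2), of "indicator S :: _ \<Rightarrow> real"]
        sets.sets_into_space[OF S] by (simp add: Int_absorb2)
    have intS: "integrable P (\<lambda>p. indicator S (?y p) :: real)"
      by (rule P.integrable_const_bound[where B=1]) auto
    have aeA: "AE p in P. ?x p \<in> A0" "AE p in P. ?z p \<in> A1"
      using AE_distrD[OF mx(1)] AE_distrD[OF mx(4)] A0(2) A1(2) unfolding dx[symmetric] dz[symmetric] by blast+
    have "(\<integral>p. (d (?x p) (?z p))\<^sup>2 / 4 + c * indicator S (?y p) \<partial>P)
        \<le> (\<integral>p. (d (?x p) (?y p))\<^sup>2 / 2 + (d (?y' p) (?z p))\<^sup>2 / 2 + 3 * \<eta> / 2 \<partial>P)"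
    proof (rule integral_mono_AE)
      show "AE p in P. (d (?x p) (?z p))\<^sup>2 / 4 + c * indicator S (?y p)
          \<le> (d (?x p) (?y p))\<^sup>2 / 2 + (d (?y' p) (?z p))\<^sup>2 / 2 + 3 * \<eta> / 2"
        using aeA close AE_space
      proof eventually_elim
        case (elim p)
        have M: "?x p \<in> M" "?y p \<in> M" "?y' p \<in> M" "?z p \<in> M" using elim(4) by (auto simp: spP)
        \<comment> \<open>Passing from \<open>?y\<close> to \<open>?y'\<close> changes the squared
          distance by at most \<open>3 * \<eta>\<close>, because \<eta> and all distances are at
          most 1.\<close>
        have "(d (?y p) (?z p))\<^sup>2 \<le> (\<eta> + d (?y' p) (?z p))\<^sup>2"
          using triangle[OF M(2,3,4)] elim(3) by (intro power_mono) auto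
        also have "\<dots> = (d (?y' p) (?z p))\<^sup>2 + \<eta> * (\<eta> + 2 * d (?y' p) (?z p))"
          by (simp add: power2_eq_square algebra_simps)
        also have "\<eta> * (\<eta> + 2 * d (?y' p) (?z p)) \<le> \<eta> * 3"
          using bounded[OF M(3,4)] eta by (intro mult_left_mono) auto
        finally have yz: "(d (?y p) (?z p))\<^sup>2 \<le> (d (?y' p) (?z p))\<^sup>2 + \<eta> * 3" by simp
        have "(d (?x p) (?z p))\<^sup>2 / 4 + c * indicator S (?y p)
            \<le> (d (?x p) (?y p))\<^sup>2 / 2 + (d (?y p) (?z p))\<^sup>2 / 2"
          using gap[OF elim(1) _ elim(2), of "?y p"] triangle_sq[OF M(1,2,4)] by (auto simp: indicator_def)
        then show ?case using yz by simp
      qed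
    qed (use int[OF mx(1,2)] int[OF mx(3,4)] int[OF mx(1,4)] intS in auto)
    moreover have "(\<integral>p. (d (?x p) (?z p))\<^sup>2 / 4 + c * indicator S (?y p) \<partial>P)
        = (\<integral>p. (d (?x p) (?z p))\<^sup>2 \<partial>P) / 4 + c * measure \<nu> S"
      using int[OF mx(1,4)] intS by (simp add: Sy)
    moreover have "(\<integral>p. (d (?x p) (?y p))\<^sup>2 / 2 + (d (?y' p) (?z p))\<^sup>2 / 2 + 3 * \<eta> / 2 \<partial>P)
        = (\<integral>p. (d (?x p) (?y p))\<^sup>2 \<partial>P) / 2 + (\<integral>p. (d (?y' p) (?z p))\<^sup>2 \<partial>P) / 2 + 3 * \<eta> / 2"
      using int[OF mx(1,2)] int[OF mx(3,4)] by (simp add: P.prob_space)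
    ultimately show ?thesis using W c1' c2' eta by (simp add: power_divide)
  qed
  \<comment> \<open>With \<eta> a quarter of \<open>c * measure \<nu> S\<close>, cut off at 1, the
    bound \<open>3 * \<eta>\<close> falls below that product.\<close>
  have "measure \<nu> S \<le> 0"
  proof (rule ccontr)
    assume "\<not> measure \<nu> S \<le> 0"
    then have pos: "c * measure \<nu> S > 0" using c by simp
    then show False using key[of "min 1 (c * measure \<nu> S / 4)"] by (cases "c * measure \<nu> S \<le> 4") auto
  qed
  then show ?thesis by (simp add: nu.emeasure_eq_measure measure_le_0_iff)
qed

end

section \<open>Relative entropy\<close>

text \<open>Jensen's inequality for \<open>r * ln r\<close>, in the form of the tangent line at
  \<open>r = 1 / q\<close>, the density of a uniform measure on a set of mass \<open>q\<close>. The
  density \<rho> vanishes almost everywhere off \<open>S\<close>, so the negative constant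
  \<open>1 / q\<close> of the tangent is subtracted on \<open>S\<close> only, where its integral is
  at most 1.\<close>

lemma relative_entropy_ge_concentrated:
  assumes m: "prob_space m" and \<mu>: "prob_space \<mu>" and sets: "sets \<mu> = sets m"
    and S: "S \<in> sets m" and conc: "AE x in \<mu>. x \<in> S" and q: "measure m S \<le> q" "q > 0"
  shows "ereal (ln (1 / q)) \<le> relative_entropy \<mu> m"
proof (cases "absolutely_continuous m \<mu>")
  case False
  then show ?thesis by (simp add: relative_entropy_def)
next
  case ac: True
  interpret m: prob_space m by fact
  interpret \<mu>: prob_space \<mu> by fact
  define \<rho> where "\<rho> = (\<lambda>x. enn2real (RN_deriv m \<mu> x))"
  have [measurable]: "\<rho> \<in> borel_measurable m" "S \<in> sets m" using S by (auto simp: \<rho>_def)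
  have "AE x in m. RN_deriv m \<mu> x \<noteq> \<infinity>"
    using m.RN_deriv_finite[OF _ ac sets] \<mu>.sigma_finite_measure_axioms by blast
  then have rn: "AE x in m. RN_deriv m \<mu> x = ennreal (\<rho> x)"
    by eventually_elim (auto simp: \<rho>_def ennreal_enn2real_if)
  have "density m (\<lambda>x. ennreal (\<rho> x)) = density m (RN_deriv m \<mu>)"
    using rn by (intro density_cong) auto
  then have dens: "density m (\<lambda>x. ennreal (\<rho> x)) = \<mu>"
    using m.density_RN_deriv[OF ac sets] by simp
  have rho0: "\<rho> x \<ge> 0" for x by (simp add: \<rho>_def)
  have "(\<integral>\<^sup>+x. ennreal (\<rho> x) \<partial>m) = emeasure \<mu> (space m)"
    unfolding dens[symmetric] by (subst emeasure_density) (auto intro!: nn_integral_cong)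
  also have "\<dots> = 1" using \<mu>.emeasure_space_1 sets_eq_imp_space_eq[OF sets] by simp
  finally have nn1: "(\<integral>\<^sup>+x. ennreal (\<rho> x) \<partial>m) = 1" .
  then have int: "integrable m \<rho>" and int1: "(\<integral>x. \<rho> x \<partial>m) = 1"
    using rho0 by (auto simp: integrable_iff_bounded integral_eq_nn_integral)
  have out: "AE x in m. x \<notin> S \<longrightarrow> \<rho> x = 0"
  proof -
    have "AE x in m. 0 < ennreal (\<rho> x) \<longrightarrow> x \<in> S"
      using conc unfolding dens[symmetric] by (subst (asm) AE_density) auto
    then show ?thesis
      by eventually_elim (use rho0 in \<open>auto simp: order.strict_iff_order\<close>)
  qed
  define h where "h = (\<lambda>x. \<rho> x * ln (\<rho> x))"
  have [measurable]: "h \<in> borel_measurable m" by (simp add: h_def)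
  \<comment> \<open>The tangent inequality is \<open>ln u \<le> u - 1\<close> at
    \<open>u = 1 / q / r\<close>, multiplied by \<open>r\<close>.\<close>
  have tangent: "r * ln (1 / q) + r - 1 / q \<le> r * ln r" if r: "r \<ge> 0" for r
  proof (cases "r = 0")
    case False
    then have r: "r > 0" using r by simp
    have "ln (1 / q / r) \<le> 1 / q / r - 1"
      using r q by (intro ln_le_minus_one) simp
    then have "r * ln (1 / q / r) \<le> r * (1 / q / r - 1)" using r by (intro mult_left_mono) auto
    also have "\<dots> = 1 / q - r" using r by (simp add: field_simps)
    finally have "r * ln (1 / q / r) \<le> 1 / q - r" .
    moreover have "r * ln (1 / q / r) = r * ln (1 / q) - r * ln r"
      using r q by (subst ln_div) (simp_all add: right_diff_distrib)
    ultimately show ?thesis by linarith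
  qed (use q in simp)
  \<comment> \<open>This keeps the integral of the negative part finite, so that the difference
    defining the entropy is never of the form infinity minus infinity.\<close>
  have neg: "- h x \<le> 1" for x
  proof (cases "\<rho> x = 0")
    case False
    then have "ln (1 / \<rho> x) \<le> 1 / \<rho> x - 1" using rho0[of x] by (intro ln_le_minus_one) simp
    then have "\<rho> x * ln (1 / \<rho> x) \<le> \<rho> x * (1 / \<rho> x - 1)" using rho0 by (intro mult_left_mono)
    then show ?thesis using False rho0[of x] by (simp add: h_def ln_div right_diff_distrib)
  qed (simp add: h_def)
  have N: "(\<integral>\<^sup>+x. ennreal (- h x) \<partial>m) \<le> 1"
    using nn_integral_mono[of m "\<lambda>x. ennreal (- h x)" "\<lambda>_. 1"] neg
    by (simp add: m.emeasure_space_1 ennreal_le_1)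
  have ent: "relative_entropy \<mu> m =
      enn2ereal (\<integral>\<^sup>+x. ennreal (h x) \<partial>m) - enn2ereal (\<integral>\<^sup>+x. ennreal (- h x) \<partial>m)"
    using ac by (simp add: relative_entropy_def h_def \<rho>_def)
  show ?thesis
  proof (cases "(\<integral>\<^sup>+x. ennreal (h x) \<partial>m) = \<top>")
    case True
    have "enn2ereal (\<integral>\<^sup>+x. ennreal (- h x) \<partial>m) \<noteq> \<infinity>"
      using N by (metis enn2ereal_top enn2ereal_inject infinity_ennreal_def ennreal_one_neq_top neq_top_trans top_ereal_def)
    then show ?thesis unfolding ent True by (simp add: top_ereal_def)
  next
    case False
    have N': "(\<integral>\<^sup>+x. ennreal (- h x) \<partial>m) \<noteq> \<top>" using N neq_top_trans by force
    have inth: "integrable m h"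
      using False N' by (simp add: real_integrable_def)
    have "(\<integral>x. h x \<partial>m) = enn2real (\<integral>\<^sup>+x. ennreal (h x) \<partial>m) - enn2real (\<integral>\<^sup>+x. ennreal (- h x) \<partial>m)"
      by (rule real_lebesgue_integral_def[OF inth])
    then have eq: "relative_entropy \<mu> m = ereal (\<integral>x. h x \<partial>m)"
      unfolding ent using False N'
      by (cases "\<integral>\<^sup>+x. ennreal (h x) \<partial>m"; cases "\<integral>\<^sup>+x. ennreal (- h x) \<partial>m") (auto simp: enn2ereal_ennreal)
    have "ln (1 / q) \<le> ln (1 / q) + 1 - measure m S / q"
      using q by simp
    also have "\<dots> = (\<integral>x. \<rho> x * ln (1 / q) + \<rho> x - indicator S x / q \<partial>m)"
      using int int1 S by (simp add: m.emeasure_eq_measure)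
    also have "\<dots> \<le> (\<integral>x. h x \<partial>m)"
    proof (rule integral_mono_AE)
      show "AE x in m. \<rho> x * ln (1 / q) + \<rho> x - indicator S x / q \<le> h x"
        using out by eventually_elim (use tangent rho0 in \<open>auto simp: h_def indicator_def\<close>)
    qed (use int inth S in \<open>auto simp: m.emeasure_eq_measure\<close>)
    finally show ?thesis by (simp add: eq)
  qed
qed

lemma uniform_measure_eq_density:
  assumes "prob_space m" "A \<in> sets m" "measure m A > 0"
  shows "uniform_measure m A = density m (\<lambda>x. ennreal (indicator A x / measure m A))"
proof -
  interpret prob_space m by fact
  show ?thesis
    unfolding uniform_measure_def using assms
    by (intro density_cong AE_I2) (auto simp: emeasure_eq_measure indicator_def divide_ennreal simp flip: ennreal_1)
qed

text \<open>The equality case of \<open>relative_entropy_ge_concentrated\<close>: the density is the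
  constant \<open>1 / measure m A\<close> on \<open>A\<close>, and as this is at least 1, the
  negative part vanishes.\<close>

lemma relative_entropy_uniform_measure:
  assumes m: "prob_space m" and A: "A \<in> sets m" "measure m A > 0"
  shows "relative_entropy (uniform_measure m A) m = ereal (ln (1 / measure m A))"
proof -
  interpret m: prob_space m by fact
  define q where "q = measure m A"
  have q: "0 < q" "q \<le> 1" using A by (auto simp: q_def)
  have U: "uniform_measure m A = density m (\<lambda>x. ennreal (indicator A x / q))"
    using uniform_measure_eq_density[OF m A] by (simp add: q_def)
  have [measurable]: "A \<in> sets m" by fact
  have ac: "absolutely_continuous m (uniform_measure m A)"
    unfolding U by (rule absolutely_continuousI_density) simp
  have "AE x in m. ennreal (indicator A x / q) = RN_deriv m (uniform_measure m A) x"
    by (rule m.RN_deriv_unique) (auto simp: U)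
  then have rn: "AE x in m. enn2real (RN_deriv m (uniform_measure m A) x) = indicator A x / q"
    by eventually_elim (use q in \<open>metis enn2real_ennreal divide_nonneg_pos indicator_pos_le\<close>)
  have lnq: "ln (1 / q) \<ge> 0" using q by simp
  let ?\<rho> = "\<lambda>x. enn2real (RN_deriv m (uniform_measure m A) x)"
  have "(\<integral>\<^sup>+x. ennreal (?\<rho> x * ln (?\<rho> x)) \<partial>m) = (\<integral>\<^sup>+x. ennreal (ln (1 / q) / q) * indicator A x \<partial>m)"
    by (rule nn_integral_cong_AE, use rn in eventually_elim) (auto simp: indicator_def)
  also have "\<dots> = ennreal (ln (1 / q))"
    using q lnq by (simp add: nn_integral_cmult_indicator m.emeasure_eq_measure q_def[symmetric] flip: ennreal_mult)
  finally have P: "(\<integral>\<^sup>+x. ennreal (?\<rho> x * ln (?\<rho> x)) \<partial>m) = ennreal (ln (1 / q))" .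
  have "(\<integral>\<^sup>+x. ennreal (- (?\<rho> x * ln (?\<rho> x))) \<partial>m) = (\<integral>\<^sup>+x. 0 \<partial>m)"
    by (rule nn_integral_cong_AE, use rn in eventually_elim)
      (use q lnq in \<open>auto simp: indicator_def ennreal_neg zero_le_divide_iff\<close>)
  then have N: "(\<integral>\<^sup>+x. ennreal (- (?\<rho> x * ln (?\<rho> x))) \<partial>m) = 0" by simp
  show ?thesis
    unfolding relative_entropy_def Let_def P N using ac lnq by (simp add: q_def enn2ereal_ennreal zero_ennreal.rep_eq)
qed

section \<open>The metric space of nondecreasing functions\<close>

text \<open>Minkowski's inequality in L2. The pointwise bound \<open>(a + b)\<^sup>2 \<le> (s + t) *
  (a\<^sup>2 / s + b\<^sup>2 / t)\<close> would give it at once with the two norms for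
  \<open>s\<close> and \<open>t\<close>.\<close>

lemma sqrt_integral_add_le:
  fixes u v :: "'a \<Rightarrow> real"
  assumes [measurable]: "u \<in> borel_measurable M" "v \<in> borel_measurable M"
    and int: "integrable M (\<lambda>x. (u x)\<^sup>2)" "integrable M (\<lambda>x. (v x)\<^sup>2)"
  shows "sqrt (\<integral>x. (u x + v x)\<^sup>2 \<partial>M) \<le> sqrt (\<integral>x. (u x)\<^sup>2 \<partial>M) + sqrt (\<integral>x. (v x)\<^sup>2 \<partial>M)"
proof (rule field_le_epsilon)
  fix e :: real assume "e > 0"
  define A where "A = sqrt (\<integral>x. (u x)\<^sup>2 \<partial>M)"
  define C where "C = sqrt (\<integral>x. (v x)\<^sup>2 \<partial>M)"
  \<comment> \<open>The extra \<open>e / 2\<close> keeps the denominators positive when a norm is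
    0.\<close>
  define s where "s = A + e / 2"
  define t where "t = C + e / 2"
  have AC: "A \<ge> 0" "C \<ge> 0" "A\<^sup>2 = (\<integral>x. (u x)\<^sup>2 \<partial>M)" "C\<^sup>2 = (\<integral>x. (v x)\<^sup>2 \<partial>M)"
    by (auto simp: A_def C_def)
  have st: "s > 0" "t > 0" "A \<le> s" "C \<le> t" using AC \<open>e > 0\<close> by (auto simp: s_def t_def)
  have pt: "(a + b)\<^sup>2 \<le> (s + t) * (a\<^sup>2 / s + b\<^sup>2 / t)" for a b
  proof -
    have "(s + t) * (a\<^sup>2 / s + b\<^sup>2 / t) - (a + b)\<^sup>2 = (t * a - s * b)\<^sup>2 / (s * t)"
      using st by (simp add: field_simps power2_eq_square)
    then show ?thesis using st by (smt (verit) divide_nonneg_pos mult_pos_pos zero_le_power2)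
  qed
  have int2: "integrable M (\<lambda>x. (s + t) * ((u x)\<^sup>2 / s + (v x)\<^sup>2 / t))"
    using int by auto
  have "(\<integral>x. (u x + v x)\<^sup>2 \<partial>M) \<le> (\<integral>x. (s + t) * ((u x)\<^sup>2 / s + (v x)\<^sup>2 / t) \<partial>M)"
    using pt by (intro integral_mono' int2) (use st in auto)
  also have "\<dots> = (s + t) * (A\<^sup>2 / s + C\<^sup>2 / t)"
    using int AC by simp
  also have "\<dots> \<le> (s + t) * (s + t)"
  proof -
    have "A * A \<le> s * s" "C * C \<le> t * t" using st AC(1,2) by (auto intro!: mult_mono)
    then have "A\<^sup>2 / s \<le> s" "C\<^sup>2 / t \<le> t"
      using st(1,2) by (simp_all add: divide_le_eq power2_eq_square)
    then show ?thesis using st by (intro mult_left_mono) auto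
  qed
  finally have "(\<integral>x. (u x + v x)\<^sup>2 \<partial>M) \<le> (s + t)\<^sup>2" by (simp add: power2_eq_square)
  then have "sqrt (\<integral>x. (u x + v x)\<^sup>2 \<partial>M) \<le> s + t"
    using st by (intro real_le_lsqrt) auto
  then show "sqrt (\<integral>x. (u x + v x)\<^sup>2 \<partial>M) \<le> A + C + e" by (simp add: s_def t_def)
qed

section \<open>Regularity and integrability of the functions in \<open>G0\<close>\<close>

lemma G0_range: "f \<in> G0 \<Longrightarrow> t \<in> {0..1} \<Longrightarrow> 0 \<le> f t \<and> f t \<le> 1"
  by (auto simp: G0_def PiE_iff)

lemma G0_at_1: "f \<in> G0 \<Longrightarrow> f 1 = 1"
  by (simp add: G0_def)

lemma G0_mono: "f \<in> G0 \<Longrightarrow> s \<in> {0..1} \<Longrightarrow> t \<in> {0..1} \<Longrightarrow> s \<le> t \<Longrightarrow> f s \<le> f t"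
  by (auto simp: G0_def mono_on_def)

text \<open>Right continuity in the form used throughout: a strict upper bound at \<open>t\<close>
  persists on an interval of positive length to the right. Lower bounds persist there by
  monotonicity, so a strict inequality between two members of \<open>G0\<close> at one time is
  visible to the L2 distance.\<close>

lemma G0_right_less:
  assumes f: "f \<in> G0" and t: "0 \<le> t" "t < 1" and less: "f t < c"
  obtains b where "t < b" "b \<le> 1" "\<And>s. t \<le> s \<Longrightarrow> s < b \<Longrightarrow> f s < c"
proof -
  have "continuous (at_right t) f" using f t by (auto simp: G0_def)
  then have "(f \<longlongrightarrow> f t) (at_right t)" by (simp add: continuous_within)
  then have "\<forall>\<^sub>F s in at_right t. f s < c" using less by (rule order_tendstoD)
  then obtain b where b: "b > t" "\<And>s. t < s \<Longrightarrow> s < b \<Longrightarrow> f s < c"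
    by (auto simp: eventually_at_right_field)
  show thesis
    by (rule that[of "min b 1"]) (use b t less in \<open>auto simp: order_le_less\<close>)
qed

lemma G0_measurable:
  assumes "f \<in> G0"
  shows "(\<lambda>t. indicator {0..1} t * f t) \<in> borel_measurable lborel"
proof -
  have "f \<in> borel_measurable (restrict_space borel {0..1})"
    using assms by (intro borel_measurable_mono_on_fnc) (auto simp: G0_def)
  then show ?thesis
    by (subst (asm) borel_measurable_restrict_space_iff) auto
qed

lemma G0_sq_integrable:
  assumes f: "f \<in> G0" and g: "g \<in> G0" and h: "h \<in> G0"
  shows "set_integrable lborel {0..1} (\<lambda>t. (a * f t + b * g t + c * h t)\<^sup>2)"
proof -
  note [measurable] = G0_measurable[OF f] G0_measurable[OF g] G0_measurable[OF h]
  have eq: "(\<lambda>t. indicator {0..1} t *\<^sub>R (a * f t + b * g t + c * h t)\<^sup>2) =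
      (\<lambda>t. (a * (indicator {0..1} t * f t) + b * (indicator {0..1} t * g t) + c * (indicator {0..1} t * h t))\<^sup>2)"
    by (auto simp: indicator_def)
  show ?thesis
    unfolding set_integrable_def
  proof (rule integrableI_bounded_set[where A="{0..1}" and B="(\<bar>a\<bar> + \<bar>b\<bar> + \<bar>c\<bar>)\<^sup>2"])
    show "(\<lambda>t. indicator {0..1} t *\<^sub>R (a * f t + b * g t + c * h t)\<^sup>2) \<in> borel_measurable lborel"
      unfolding eq by measurable
    show "AE t in lborel. t \<in> {0..1} \<longrightarrow>
        norm (indicator {0..1} t *\<^sub>R (a * f t + b * g t + c * h t)\<^sup>2) \<le> (\<bar>a\<bar> + \<bar>b\<bar> + \<bar>c\<bar>)\<^sup>2"
    proof (intro AE_I2 impI)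
      fix t :: real assume t: "t \<in> {0..1}"
      have *: "\<bar>r * p t\<bar> \<le> \<bar>r\<bar>" if "p \<in> G0" for p and r :: real
        using G0_range[OF that t] by (simp add: abs_mult mult_left_le)
      have "\<bar>a * f t + b * g t + c * h t\<bar> \<le> \<bar>a\<bar> + \<bar>b\<bar> + \<bar>c\<bar>"
        using *[OF f, of a] *[OF g, of b] *[OF h, of c] by linarith
      then have "\<bar>a * f t + b * g t + c * h t\<bar>\<^sup>2 \<le> (\<bar>a\<bar> + \<bar>b\<bar> + \<bar>c\<bar>)\<^sup>2" by (intro power_mono) auto
      then show "norm (indicator {0..1} t *\<^sub>R (a * f t + b * g t + c * h t)\<^sup>2) \<le> (\<bar>a\<bar> + \<bar>b\<bar> + \<bar>c\<bar>)\<^sup>2"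
        using t by simp
    qed
  qed auto
qed

lemma G0_diff_integrable:
  assumes "f \<in> G0" "g \<in> G0"
  shows "set_integrable lborel {0..1} (\<lambda>t. (f t - g t)\<^sup>2)"
  using G0_sq_integrable[OF assms assms(1), of 1 "-1" 0] by simp

lemma L2_dist_sq: "(L2_dist f g)\<^sup>2 = (LBINT t:{0..1}. (f t - g t)\<^sup>2)"
proof -
  have "(LBINT t:{0..1}. (f t - g t)\<^sup>2) \<ge> 0"
    unfolding set_lebesgue_integral_def by (rule Bochner_Integration.integral_nonneg) auto
  then show ?thesis by (simp add: L2_dist_def)
qed

text \<open>The parallelogram identity, with the distance of \<open>y\<close> from the midpoint of \<open>x\<close> and \<open>z\<close>
  estimated on \<open>[a, b)\<close> only.\<close>

lemma L2_dist_midpoint_gap: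
  assumes G0: "x \<in> G0" "y \<in> G0" "z \<in> G0" and ab: "0 \<le> a" "a \<le> b" "b \<le> 1" and c: "c \<ge> 0"
    and gap: "\<And>t. a \<le> t \<Longrightarrow> t < b \<Longrightarrow> c \<le> \<bar>y t - (x t + z t) / 2\<bar>"
  shows "(L2_dist x z)\<^sup>2 / 4 + c\<^sup>2 * (b - a) \<le> (L2_dist x y)\<^sup>2 / 2 + (L2_dist y z)\<^sup>2 / 2"
proof -
  note xz = G0_diff_integrable[OF G0(1,3)] and xy = G0_diff_integrable[OF G0(1,2)]
    and yz = G0_diff_integrable[OF G0(2,3)]
  have ind: "set_integrable lborel {0..1} (\<lambda>t. c\<^sup>2 * indicator {a..<b} t)"
    unfolding set_integrable_def
    by (rule integrableI_bounded_set[where A="{0..1}" and B="c\<^sup>2"]) (auto simp: indicator_def)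
  have "(LBINT t:{0..1}. c\<^sup>2 * indicator {a..<b} t) = (LBINT t. c\<^sup>2 * indicator {a..<b} t)"
    unfolding set_lebesgue_integral_def using ab
    by (intro Bochner_Integration.integral_cong) (auto simp: indicator_def)
  also have "\<dots> = c\<^sup>2 * (b - a)" using ab by simp
  finally have E: "(LBINT t:{0..1}. c\<^sup>2 * indicator {a..<b} t) = c\<^sup>2 * (b - a)" .
  have "(L2_dist x z)\<^sup>2 / 4 + c\<^sup>2 * (b - a)
      = (LBINT t:{0..1}. (x t - z t)\<^sup>2 / 4 + c\<^sup>2 * indicator {a..<b} t)"
    unfolding L2_dist_sq by (simp only: E[symmetric]) (use xz ind in \<open>simp add: set_integral_add\<close>)
  also have "\<dots> \<le> (LBINT t:{0..1}. (x t - y t)\<^sup>2 / 2 + (y t - z t)\<^sup>2 / 2)"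
  proof (rule set_integral_mono)
    fix t :: real assume "t \<in> {0..1}"
    have id: "(x t - y t)\<^sup>2 / 2 + (y t - z t)\<^sup>2 / 2 = (x t - z t)\<^sup>2 / 4 + (y t - (x t + z t) / 2)\<^sup>2"
      by (simp add: power2_eq_square field_simps)
    have "c\<^sup>2 * indicator {a..<b} t \<le> (y t - (x t + z t) / 2)\<^sup>2"
    proof (cases "t \<in> {a..<b}")
      case True
      then have "c\<^sup>2 \<le> \<bar>y t - (x t + z t) / 2\<bar>\<^sup>2" using gap[of t] c by (intro power_mono) auto
      then show ?thesis using True by simp
    qed simp
    then show "(x t - z t)\<^sup>2 / 4 + c\<^sup>2 * indicator {a..<b} t \<le> (x t - y t)\<^sup>2 / 2 + (y t - z t)\<^sup>2 / 2"
      unfolding id by simp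
  qed (use xz xy yz ind in auto)
  also have "\<dots> = (L2_dist x y)\<^sup>2 / 2 + (L2_dist y z)\<^sup>2 / 2"
    unfolding L2_dist_sq using xy yz by (simp add: set_integral_add)
  finally show ?thesis .
qed

section \<open>Metric axioms for \<open>L2_dist\<close>\<close>

lemma L2_dist_self [simp]: "L2_dist f f = 0"
  by (simp add: L2_dist_def set_lebesgue_integral_def)

lemma L2_dist_commute: "L2_dist f g = L2_dist g f"
  by (simp add: L2_dist_def power2_commute)

text \<open>The case of equal end points in \<open>L2_dist_midpoint_gap\<close>: the midpoint of
  \<open>g\<close> and \<open>g\<close> is \<open>g\<close> itself.\<close>

lemma L2_dist_ge:
  assumes "f \<in> G0" "g \<in> G0" "0 \<le> a" "a \<le> b" "b \<le> 1" "c \<ge> 0"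
    and "\<And>t. a \<le> t \<Longrightarrow> t < b \<Longrightarrow> c \<le> \<bar>f t - g t\<bar>"
  shows "c\<^sup>2 * (b - a) \<le> (L2_dist f g)\<^sup>2"
  using L2_dist_midpoint_gap[of g f g a b c] assms by (simp add: L2_dist_commute[of g f])

text \<open>If \<open>p t < q t\<close> for some \<open>t < 1\<close>, then on a right neighbourhood
  \<open>p\<close> stays below the mean of the two values, while \<open>q\<close> stays above
  \<open>q t\<close>; the distance is then positive. The time 1 is settled by the common value 1,
  and times outside [0, 1] by extensionality.\<close>

lemma G0_eqI:
  assumes f: "f \<in> G0" and g: "g \<in> G0" and zero: "L2_dist f g = 0"
  shows "f = g"
proof (rule ext)
  have le: "\<not> p t < q t" if pq: "p \<in> G0" "q \<in> G0" "L2_dist p q = 0" and t: "0 \<le> t" "t < 1" for p q t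
  proof
    assume "p t < q t"
    then obtain b where b: "t < b" "b \<le> 1" "\<And>s. t \<le> s \<Longrightarrow> s < b \<Longrightarrow> p s < (p t + q t) / 2"
      using G0_right_less[OF pq(1) t, of "(p t + q t) / 2"] by auto
    have "((q t - p t) / 2)\<^sup>2 * (b - t) \<le> (L2_dist p q)\<^sup>2"
    proof (rule L2_dist_ge[OF pq(1,2)])
      fix s assume s: "t \<le> s" "s < b"
      have "q t \<le> q s" using s t b by (intro G0_mono[OF pq(2)]) auto
      then show "(q t - p t) / 2 \<le> \<bar>p s - q s\<bar>" using b(3)[OF s] abs_ge_minus_self[of "p s - q s"] by (simp add: field_simps)
    qed (use t b \<open>p t < q t\<close> in auto)
    moreover have "((q t - p t) / 2)\<^sup>2 * (b - t) > 0" using b \<open>p t < q t\<close> by simp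
    ultimately show False using pq by simp
  qed
  fix t :: real
  consider "0 \<le> t \<and> t < 1" | "t = 1" | "t \<notin> {0..1}" by force
  then show "f t = g t"
  proof cases
    case 1
    then show ?thesis using le[OF f g zero, of t] le[OF g f, of t] zero by (auto simp: L2_dist_commute)
  next
    case 2
    then show ?thesis using f g by (simp add: G0_def)
  next
    case 3
    then show ?thesis using f g by (auto simp: G0_def PiE_iff extensional_def)
  qed
qed

lemma L2_dist_triangle:
  assumes f: "f \<in> G0" and g: "g \<in> G0" and h: "h \<in> G0"
  shows "L2_dist f h \<le> L2_dist f g + L2_dist g h"
proof -
  define I where "I p = (\<lambda>t. indicator {0..1} t * p t)" for p :: "real \<Rightarrow> real"
  have eq: "(LBINT t:{0..1}. (p t - q t)\<^sup>2) = (LBINT t. (I p t - I q t)\<^sup>2)" for p q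
    unfolding set_lebesgue_integral_def I_def
    by (intro Bochner_Integration.integral_cong) (auto simp: indicator_def)
  have int: "integrable lborel (\<lambda>t. (I p t - I q t)\<^sup>2)" if "p \<in> G0" "q \<in> G0" for p q
  proof -
    have "(\<lambda>t. indicator {0..1} t *\<^sub>R (p t - q t)\<^sup>2) = (\<lambda>t. (I p t - I q t)\<^sup>2)"
      by (auto simp: I_def indicator_def)
    then show ?thesis using G0_diff_integrable[OF that] by (simp add: set_integrable_def)
  qed
  have meas: "(\<lambda>t. I p t - I q t) \<in> borel_measurable lborel" if "p \<in> G0" "q \<in> G0" for p q
    using G0_measurable[OF that(1)] G0_measurable[OF that(2)] by (simp add: I_def)
  show ?thesis
    using sqrt_integral_add_le[OF meas[OF f g] meas[OF g h] int[OF f g] int[OF g h]]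
    by (simp add: L2_dist_def eq)
qed

lemma Metric_space_G0: "Metric_space G0 L2_dist"
proof
  show "0 \<le> L2_dist f g" for f g
    unfolding L2_dist_def set_lebesgue_integral_def
    by (intro real_sqrt_ge_zero Bochner_Integration.integral_nonneg) auto
qed (auto intro: L2_dist_commute G0_eqI L2_dist_triangle)

interpretation G0: Metric_space G0 L2_dist by (rule Metric_space_G0)

abbreviation "borel_G0 \<equiv> borel_of_topology (Metric_space.mtopology G0 L2_dist)"

section \<open>Diameter, measurable evaluations and small cells\<close>

lemma L2_dist_le_1:
  assumes f: "f \<in> G0" and g: "g \<in> G0"
  shows "L2_dist f g \<le> 1"
proof -
  have "(LBINT t:{0..1}. (f t - g t)\<^sup>2) \<le> (LBINT t::real:{0..1}. 1)"
  proof (rule set_integral_mono[OF G0_diff_integrable[OF f g]])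
    show "set_integrable lborel {0..1 :: real} (\<lambda>t. 1 :: real)"
      by (simp add: set_integrable_def)
    fix t :: real assume t: "t \<in> {0..1}"
    show "(f t - g t)\<^sup>2 \<le> 1"
      unfolding abs_square_le_1 using G0_range[OF f t] G0_range[OF g t] by linarith
  qed
  also have "\<dots> = 1" by (simp add: set_lebesgue_integral_def)
  finally show ?thesis by (simp add: L2_dist_def)
qed

text \<open>Evaluation at a time is not continuous for the L2 distance, since jumps may move, but it
  is upper semicontinuous, which suffices for Borel measurability. If
  \<open>h t \<ge> c > g t\<close>, then \<open>h\<close> exceeds \<open>g\<close> by at least
  \<open>(c - g t) / 2\<close> on some \<open>[t, b)\<close> depending on \<open>g\<close> alone,
  which yields the radius \<open>r\<close>.\<close>

lemma openin_G0_less: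
  assumes t: "0 \<le> t" "t < 1"
  shows "openin G0.mtopology {g \<in> G0. g t < c}"
  unfolding G0.openin_mtopology
proof (intro conjI allI impI)
  fix g assume "g \<in> {g \<in> G0. g t < c}"
  then have g: "g \<in> G0" "g t < c" by auto
  then obtain b where b: "t < b" "b \<le> 1" "\<And>s. t \<le> s \<Longrightarrow> s < b \<Longrightarrow> g s < (g t + c) / 2"
    using G0_right_less[OF g(1) t, of "(g t + c) / 2"] by auto
  define r where "r = sqrt (((c - g t) / 2)\<^sup>2 * (b - t))"
  have "r > 0" using b g by (simp add: r_def)
  moreover have "G0.mball g r \<subseteq> {g \<in> G0. g t < c}"
  proof (clarsimp, rule ccontr)
    fix h assume h: "h \<in> G0" "L2_dist g h < r" "\<not> h t < c"
    have "((c - g t) / 2)\<^sup>2 * (b - t) \<le> (L2_dist g h)\<^sup>2"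
    proof (rule L2_dist_ge[OF g(1) h(1)])
      fix s assume s: "t \<le> s" "s < b"
      have "h t \<le> h s" using s t b by (intro G0_mono[OF h(1)]) auto
      then show "(c - g t) / 2 \<le> \<bar>g s - h s\<bar>" using b(3)[OF s] h(3) abs_ge_minus_self[of "g s - h s"] by (simp add: field_simps)
    qed (use t b g in auto)
    then have "r \<le> L2_dist g h" unfolding r_def by (rule real_le_lsqrt[rotated]) simp
    then show False using h by simp
  qed
  ultimately show "\<exists>r>0. G0.mball g r \<subseteq> {g \<in> G0. g t < c}" by blast
qed auto

lemma space_borel_G0: "space borel_G0 = G0"
  by simp

lemma measurable_G0_eval:
  assumes "t \<in> {0..1}"
  shows "(\<lambda>g. g t) \<in> borel_measurable borel_G0"
proof (cases "t = 1")
  case True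
  have "(\<lambda>g. g t) \<in> borel_measurable borel_G0 \<longleftrightarrow> (\<lambda>g. 1 :: real) \<in> borel_measurable borel_G0"
    by (rule measurable_cong) (simp add: True G0_at_1)
  then show ?thesis by simp
next
  case False
  then show ?thesis
    using assms borel_of_topology_open[OF openin_G0_less[of t]] by (auto simp: borel_measurable_iff_less)
qed

text \<open>Between neighbouring grid points, monotonicity bounds the difference of \<open>f\<close>
  and \<open>g\<close> by the increment of \<open>f\<close> plus \<open>1 / n\<close>, and its
  square is no larger as values lie in [0, 1]. The increments telescope to at most 1, the other
  terms add up to 1, and each interval has length \<open>1 / n\<close>.\<close>

lemma L2_dist_le_grid:
  assumes f: "f \<in> G0" and g: "g \<in> G0" and n: "n > 0"
    and grid: "\<And>i. i \<le> n \<Longrightarrow> \<bar>f (real i / real n) - g (real i / real n)\<bar> \<le> 1 / real n"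
  shows "(L2_dist f g)\<^sup>2 \<le> 2 / real n"
proof -
  define D where "D i = f (real (Suc i) / real n) - f (real i / real n) + 1 / real n" for i
  define I where "I i = {real i / real n..real (Suc i) / real n}" for i
  have D0: "D i \<ge> 0" if "i < n" for i
    using that G0_mono[OF f, of "real i / real n" "real (Suc i) / real n"] by (auto simp: D_def divide_right_mono)
  have int: "integrable lborel (\<lambda>t. \<Sum>i<n. D i * indicator (I i) t)"
    by (intro Bochner_Integration.integrable_sum integrable_mult_right integrable_real_indicator)
      (auto simp: I_def emeasure_lborel_Icc_eq)
  have "(L2_dist f g)\<^sup>2 = (LBINT t. indicator {0..1} t *\<^sub>R (f t - g t)\<^sup>2)"
    unfolding L2_dist_sq set_lebesgue_integral_def ..
  also have "\<dots> \<le> (LBINT t. \<Sum>i<n. D i * indicator (I i) t)"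
  proof (rule integral_mono'[OF int])
    fix t :: real
    show "0 \<le> (\<Sum>i<n. D i * indicator (I i) t)" using D0 by (intro sum_nonneg) auto
    show "indicator {0..1} t *\<^sub>R (f t - g t)\<^sup>2 \<le> (\<Sum>i<n. D i * indicator (I i) t)"
    proof (cases "t \<in> {0..1}")
      case True
      \<comment> \<open>The minimum matters at \<open>t = 1\<close> only, where the floor would give
        the index \<open>n\<close> instead of the last interval \<open>n - 1\<close>.\<close>
      define i where "i = min (nat \<lfloor>real n * t\<rfloor>) (n - 1)"
      have i: "i < n" using n by (auto simp: i_def)
      have ti: "t \<in> I i"
      proof (cases "t = 1")
        case True
        then have "i = n - 1" by (simp add: i_def)
        then show ?thesis using n True by (auto simp: I_def)
      next
        case False
        have "real n * t < real n" "real n * t \<ge> 0" using \<open>t \<in> {0..1}\<close> False n by auto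
        then have "nat \<lfloor>real n * t\<rfloor> < n" by linarith
        then have "i = nat \<lfloor>real n * t\<rfloor>" by (simp add: i_def)
        then have "real i \<le> real n * t" "real n * t \<le> real (Suc i)"
          using \<open>real n * t \<ge> 0\<close> by linarith+
        then show ?thesis using n by (auto simp: I_def field_simps)
      qed
      have pts: "real i / real n \<in> {0..1}" "real (Suc i) / real n \<in> {0..1}" using i by auto
      have t1: "real i / real n \<le> t" "t \<le> real (Suc i) / real n" using ti by (auto simp: I_def)
      have "\<bar>f t - g t\<bar> \<le> D i"
        using G0_mono[OF f pts(1) True t1(1)] G0_mono[OF f True pts(2) t1(2)]
          G0_mono[OF g pts(1) True t1(1)] G0_mono[OF g True pts(2) t1(2)] grid[of i] grid[of "Suc i"] i unfolding D_def by linarith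
      moreover have "(f t - g t)\<^sup>2 \<le> \<bar>f t - g t\<bar>"
        using G0_range[OF f True] G0_range[OF g True]
        by (subst power2_abs[symmetric], subst power2_eq_square) (intro mult_left_le, auto)
      ultimately have "(f t - g t)\<^sup>2 \<le> D i * indicator (I i) t" using ti by simp
      also have "\<dots> \<le> (\<Sum>i<n. D i * indicator (I i) t)"
        using i D0 by (intro member_le_sum) auto
      finally show ?thesis using True by simp
    qed (use \<open>0 \<le> (\<Sum>i<n. D i * indicator (I i) t)\<close> in simp)
  qed
  also have "\<dots> = (\<Sum>i<n. D i * measure lborel (I i))"
    by (subst Bochner_Integration.integral_sum)
      (auto simp: I_def emeasure_lborel_Icc_eq intro!: integrable_mult_right integrable_real_indicator)
  also have "\<dots> = (\<Sum>i<n. D i) * (1 / real n)"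
  proof -
    have "measure lborel (I i) = 1 / real n" for i
      using n by (simp add: I_def divide_right_mono diff_divide_distrib[symmetric])
    then show ?thesis by (simp add: sum_divide_distrib)
  qed
  also have "(\<Sum>i<n. D i) = f (real n / real n) - f (real 0 / real n) + 1"
  proof -
    have "(\<Sum>i<n. f (real (Suc i) / real n) - f (real i / real n)) = f (real n / real n) - f (real 0 / real n)"
      by (rule sum_lessThan_telescope)
    then show ?thesis unfolding D_def using n by (simp add: sum.distrib)
  qed
  also have "(f (real n / real n) - f (real 0 / real n) + 1) * (1 / real n) \<le> 2 * (1 / real n)"
    using n G0_range[OF f, of 1] G0_range[OF f, of 0] by (intro mult_right_mono) auto
  finally show ?thesis by simp
qed

text \<open>The cell of \<open>g\<close> records its values at the \<open>n + 1\<close> grid points,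
  rounded down to multiples of \<open>1 / n\<close>; the list is coded as one natural number. Equal
  codes mean grid values within \<open>1 / n\<close> of each other, so
  \<open>L2_dist_le_grid\<close> bounds the diameter of a cell.\<close>

lemma bounded_cell_metric_G0: "bounded_cell_metric G0 L2_dist"
proof (rule bounded_cell_metric.intro[OF Metric_space_G0], unfold_locales)
  show "L2_dist f g \<le> 1" if "f \<in> G0" "g \<in> G0" for f g using L2_dist_le_1[OF that] .
  fix r :: real assume r: "r > 0"
  obtain n :: nat where n: "n > 0" "2 / real n \<le> r\<^sup>2"
  proof -
    obtain k where "inverse (real (Suc k)) < r\<^sup>2 / 2" using reals_Archimedean[of "r\<^sup>2 / 2"] r by auto
    then show thesis by (intro that[of "Suc k"]) (auto simp: inverse_eq_divide)
  qed
  define F where "F i g = nat \<lfloor>real n * g (real i / real n)\<rfloor>" for i and g :: "real \<Rightarrow> real"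
  define L where "L g = map (\<lambda>i. F i g) [0..<Suc n]" for g
  have F: "{g \<in> G0. F i g = k} \<in> sets borel_G0" if "i \<le> n" for i k
  proof -
    have [measurable]: "(\<lambda>g. g (real i / real n)) \<in> borel_measurable borel_G0"
      using that n by (intro measurable_G0_eval) auto
    have "{g \<in> space borel_G0. F i g = k} \<in> sets borel_G0"
      unfolding F_def by measurable
    then show ?thesis by simp
  qed
  have "L \<in> borel_G0 \<rightarrow>\<^sub>M count_space UNIV"
    unfolding measurable_count_space_eq2_countable
  proof (intro conjI ballI)
    fix xs :: "nat list"
    show "L -` {xs} \<inter> space borel_G0 \<in> sets borel_G0"
    proof (cases "length xs = Suc n")
      case True
      then have "L -` {xs} \<inter> space borel_G0 = (\<Inter>i\<in>{..n}. {g \<in> G0. F i g = xs ! i})"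
        by (auto simp: L_def list_eq_iff_nth_eq less_Suc_eq_le simp del: upt_Suc)
      then show ?thesis using F by (auto intro!: sets.finite_INT)
    next
      case False
      then have "L -` {xs} \<inter> space borel_G0 = {}" by (auto simp: L_def simp del: upt_Suc)
      then show ?thesis by simp
    qed
  qed auto
  then have "(\<lambda>g. to_nat (L g)) \<in> borel_G0 \<rightarrow>\<^sub>M count_space UNIV"
    by (rule measurable_compose) simp
  moreover have "L2_dist f g \<le> r" if f: "f \<in> G0" and g: "g \<in> G0" and eq: "to_nat (L f) = to_nat (L g)" for f g
  proof -
    have "L f = L g" using eq by simp
    then have Feq: "F i f = F i g" if "i \<le> n" for i
      using that by (auto simp: L_def simp del: upt_Suc)
    have "(L2_dist f g)\<^sup>2 \<le> 2 / real n"
    proof (rule L2_dist_le_grid[OF f g n(1)])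
      fix i assume i: "i \<le> n"
      then have "0 \<le> f (real i / real n)" "0 \<le> g (real i / real n)"
        using G0_range[OF f, of "real i / real n"] G0_range[OF g, of "real i / real n"] n by auto
      then have "0 \<le> real n * f (real i / real n)" "0 \<le> real n * g (real i / real n)" by auto
      then have "\<bar>real n * f (real i / real n) - real n * g (real i / real n)\<bar> \<le> 1"
        using Feq[OF i] unfolding F_def by linarith
      then show "\<bar>f (real i / real n) - g (real i / real n)\<bar> \<le> 1 / real n"
        using n by (simp add: field_simps abs_le_iff)
    qed
    also have "\<dots> \<le> r\<^sup>2" by (rule n(2))
    finally show ?thesis by (rule power2_le_imp_le) (use r in simp)
  qed
  ultimately show "\<exists>\<kappa> :: (real \<Rightarrow> real) \<Rightarrow> nat. \<kappa> \<in> borel_G0 \<rightarrow>\<^sub>M count_space UNIV \<and>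
      (\<forall>x\<in>G0. \<forall>y\<in>G0. \<kappa> x = \<kappa> y \<longrightarrow> L2_dist x y \<le> r)"
    by blast
qed

section \<open>Probabilities of small cylinder sets\<close>

interpretation G0: bounded_cell_metric G0 L2_dist by (rule bounded_cell_metric_G0)

section \<open>The Dirichlet law of finitely many values\<close>

lemma entropic_measureD:
  assumes "entropic_measure \<beta> Q"
  shows "prob_space Q" "sets Q = sets borel_G0" "space Q = G0"
proof -
  show "prob_space Q" and s: "sets Q = sets borel_G0"
    using assms by (auto simp: entropic_measure_def borel_prob_measures_def)
  show "space Q = G0" using sets_eq_imp_space_eq[OF s] by simp
qed

text \<open>Unnormalized density of the partial sums of a Dirichlet vector with parameters
  \<open>\<beta> * (t (Suc i) - t i)\<close>. It is integrated over \<open>ordered_simplex\<close>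
  only; its values elsewhere carry no meaning.\<close>

definition dirichlet_density :: "real \<Rightarrow> nat \<Rightarrow> (nat \<Rightarrow> real) \<Rightarrow> (nat \<Rightarrow> real) \<Rightarrow> real" where
  "dirichlet_density \<beta> N t x = (\<Prod>i=0..N. (with_endpoints N x (Suc i) - with_endpoints N x i)
     powr (\<beta> * (t (Suc i) - t i) - 1))"

definition dirichlet_const :: "real \<Rightarrow> nat \<Rightarrow> (nat \<Rightarrow> real) \<Rightarrow> real" where
  "dirichlet_const \<beta> N t = Gamma \<beta> / (\<Prod>i=0..N. Gamma (\<beta> * (t (Suc i) - t i)))"

lemma dirichlet_const_pos:
  assumes "\<beta> > 0" "\<forall>i\<le>N. t i < t (Suc i)"
  shows "dirichlet_const \<beta> N t > 0"
  unfolding dirichlet_const_def using assms by (auto intro!: divide_pos_pos prod_pos Gamma_real_pos)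

lemma dirichlet_density_nonneg: "dirichlet_density \<beta> N t x \<ge> 0"
  unfolding dirichlet_density_def by (intro prod_nonneg) auto

definition cylinder :: "nat \<Rightarrow> (nat \<Rightarrow> real) \<Rightarrow> (nat \<Rightarrow> real set) \<Rightarrow> (real \<Rightarrow> real) set" where
  "cylinder N t J = {g \<in> G0. \<forall>i\<in>{1..N}. g (t i) \<in> J i}"

context
  fixes \<beta> :: real and Q N and t :: "nat \<Rightarrow> real"
  assumes \<beta>: "\<beta> > 0" and Q: "entropic_measure \<beta> Q"
    and t: "t 0 = 0" "t (Suc N) = 1" "\<forall>i\<le>N. t i < t (Suc i)"
begin

lemma cylinder_prob:
  assumes J: "\<And>i. i \<in> {1..N} \<Longrightarrow> J i \<in> sets borel"
  shows "measure Q (cylinder N t J) = dirichlet_const \<beta> N t *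
    (LINT x:ordered_simplex N|(\<Pi>\<^sub>M i\<in>{1..N}. lborel).
       indicator (PiE {1..N} J) x * dirichlet_density \<beta> N t x)"
proof -
  let ?u = "indicator (PiE {1..N} J) :: (nat \<Rightarrow> real) \<Rightarrow> real"
  let ?I = "(\<Pi>\<^sub>M i\<in>{1..N}. restrict_space borel {0..1 :: real})"
  have "PiE {1..N} J \<inter> space ?I = PiE {1..N} (\<lambda>i. J i \<inter> {0..1})"
    by (auto simp: space_PiM space_restrict_space PiE_iff)
  also have "\<dots> \<in> sets ?I"
    using J by (intro sets_PiM_I_finite) (auto simp: sets_restrict_space)
  finally have u: "?u \<in> borel_measurable ?I"
    by (simp add: borel_measurable_indicator_iff)
  have "bounded (?u ` ({1..N} \<rightarrow>\<^sub>E {0..1}))"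
    by (rule bounded_subset[of "{0..1}"]) (auto simp: indicator_def)
  then have "(\<integral>g. ?u (\<lambda>i\<in>{1..N}. g (t i)) \<partial>Q) = dirichlet_const \<beta> N t *
    (LINT x:ordered_simplex N|(\<Pi>\<^sub>M i\<in>{1..N}. lborel). ?u x * dirichlet_density \<beta> N t x)"
    using Q t u unfolding entropic_measure_def dirichlet_const_def dirichlet_density_def by blast
  moreover have "(\<integral>g. ?u (\<lambda>i\<in>{1..N}. g (t i)) \<partial>Q) = (\<integral>g. indicator (cylinder N t J) g \<partial>Q)"
    using entropic_measureD(3)[OF Q]
    by (intro Bochner_Integration.integral_cong) (auto simp: indicator_def cylinder_def PiE_iff)
  moreover have "cylinder N t J \<inter> space Q = cylinder N t J"
    using entropic_measureD(3)[OF Q] by (auto simp: cylinder_def)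
  ultimately show ?thesis by simp
qed

text \<open>The Bochner integral of a non-integrable function is 0 by default. Were the density not
  integrable, the defining formula applied to the sure event would give \<open>Q\<close> total mass
  0. Integrability is thus read off from the existence of \<open>Q\<close>, without evaluating the
  Dirichlet integral.\<close>

lemma dirichlet_integrable:
  "set_integrable (\<Pi>\<^sub>M i\<in>{1..N}. lborel) (ordered_simplex N) (dirichlet_density \<beta> N t)"
proof (rule ccontr)
  interpret Q: prob_space Q using entropic_measureD(1)[OF Q] .
  assume "\<not> ?thesis"
  then have "(LINT x:ordered_simplex N|(\<Pi>\<^sub>M i\<in>{1..N}. lborel). dirichlet_density \<beta> N t x) = 0"
    unfolding set_integrable_def set_lebesgue_integral_def by (rule not_integrable_integral_eq)
  moreover have "(LINT x:ordered_simplex N|(\<Pi>\<^sub>M i\<in>{1..N}. lborel).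
        indicator (PiE {1..N} (\<lambda>_. UNIV)) x * dirichlet_density \<beta> N t x)
      = (LINT x:ordered_simplex N|(\<Pi>\<^sub>M i\<in>{1..N}. lborel). dirichlet_density \<beta> N t x)"
    unfolding set_lebesgue_integral_def
    by (intro Bochner_Integration.integral_cong) (auto simp: indicator_def ordered_simplex_def PiE_iff)
  moreover have "cylinder N t (\<lambda>_. UNIV) = space Q"
    using entropic_measureD(3)[OF Q] by (auto simp: cylinder_def)
  ultimately show False using cylinder_prob[of "\<lambda>_. UNIV"] by (simp add: Q.prob_space)
qed

lemma box_measure:
  fixes a b :: "nat \<Rightarrow> real"
  assumes "\<And>i. i \<in> {1..N} \<Longrightarrow> a i \<le> b i"
  shows "emeasure (\<Pi>\<^sub>M i\<in>{1..N}. lborel) (PiE {1..N} (\<lambda>i. {a i..b i})) = ennreal (\<Prod>i=1..N. b i - a i)"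
proof -
  interpret product_sigma_finite "\<lambda>_::nat. lborel :: real measure" ..
  show ?thesis
    using assms by (subst emeasure_PiM) (auto intro!: prod_ennreal)
qed

text \<open>For the lower bound the whole box has to lie in the simplex, because any part outside
  carries no mass but counts in the volume; for the upper bound only the part inside
  matters.\<close>

lemma cylinder_prob_bounds:
  assumes ab: "\<And>i. i \<in> {1..N} \<Longrightarrow> a i \<le> b i"
  shows cylinder_prob_ge: "(\<And>x. x \<in> PiE {1..N} (\<lambda>i. {a i..b i}) \<Longrightarrow>
        x \<in> ordered_simplex N \<and> c \<le> dirichlet_density \<beta> N t x) \<Longrightarrow>
      dirichlet_const \<beta> N t * (c * (\<Prod>i=1..N. b i - a i)) \<le> measure Q (cylinder N t (\<lambda>i. {a i..b i}))"
    and cylinder_prob_le: "c \<ge> 0 \<Longrightarrow> (\<And>x. x \<in> PiE {1..N} (\<lambda>i. {a i..b i}) \<Longrightarrow>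
        x \<in> ordered_simplex N \<Longrightarrow> dirichlet_density \<beta> N t x \<le> c) \<Longrightarrow>
      measure Q (cylinder N t (\<lambda>i. {a i..b i})) \<le> dirichlet_const \<beta> N t * (c * (\<Prod>i=1..N. b i - a i))"
proof -
  let ?L = "\<Pi>\<^sub>M i\<in>{1..N}. (lborel :: real measure)"
  let ?X = "PiE {1..N} (\<lambda>i. {a i..b i})"
  have X: "?X \<in> sets ?L" by (intro sets_PiM_I_finite) auto
  have Xm: "measure ?L ?X = (\<Prod>i=1..N. b i - a i)"
  proof -
    have "0 \<le> (\<Prod>i=1..N. b i - a i)" using ab by (intro prod_nonneg) auto
    then show ?thesis using box_measure[of a b] ab by (simp add: measure_def)
  qed
  have Xi: "integrable ?L (\<lambda>x. c * indicator ?X x)"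
    using X box_measure[of a b] ab by (intro integrable_mult_right integrable_real_indicator) auto
  have XI: "(\<integral>x. c * indicator ?X x \<partial>?L) = c * (\<Prod>i=1..N. b i - a i)"
    using X Xm sets.sets_into_space[OF X] by (simp add: Int_absorb2)
  have di: "integrable ?L (\<lambda>x. indicator (ordered_simplex N) x *\<^sub>R (indicator ?X x * dirichlet_density \<beta> N t x))"
  proof -
    have "integrable ?L (\<lambda>x. indicator (ordered_simplex N) x *\<^sub>R dirichlet_density \<beta> N t x * indicator ?X x)"
      using integrable_real_mult_indicator[OF X dirichlet_integrable[unfolded set_integrable_def]] .
    then show ?thesis by (simp add: ac_simps)
  qed
  have C: "dirichlet_const \<beta> N t \<ge> 0" using dirichlet_const_pos[OF \<beta> t(3)] by simp
  have prob: "measure Q (cylinder N t (\<lambda>i. {a i..b i})) = dirichlet_const \<beta> N t *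
      (\<integral>x. indicator (ordered_simplex N) x *\<^sub>R (indicator ?X x * dirichlet_density \<beta> N t x) \<partial>?L)"
    using cylinder_prob[of "\<lambda>i. {a i..b i}"] by (simp add: set_lebesgue_integral_def)
  {
    assume *: "\<And>x. x \<in> ?X \<Longrightarrow> x \<in> ordered_simplex N \<and> c \<le> dirichlet_density \<beta> N t x"
    show "dirichlet_const \<beta> N t * (c * (\<Prod>i=1..N. b i - a i)) \<le> measure Q (cylinder N t (\<lambda>i. {a i..b i}))"
      unfolding prob XI[symmetric]
      by (rule mult_left_mono[OF integral_mono[OF Xi di] C]) (use * in \<open>auto simp: indicator_def dirichlet_density_nonneg\<close>)
  }
  {
    assume c: "c \<ge> 0" and *: "\<And>x. x \<in> ?X \<Longrightarrow> x \<in> ordered_simplex N \<Longrightarrow> dirichlet_density \<beta> N t x \<le> c"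
    show "measure Q (cylinder N t (\<lambda>i. {a i..b i})) \<le> dirichlet_const \<beta> N t * (c * (\<Prod>i=1..N. b i - a i))"
      unfolding prob XI[symmetric]
      by (rule mult_left_mono[OF integral_mono[OF di Xi] C]) (use * c in \<open>auto simp: indicator_def dirichlet_density_nonneg\<close>)
  }
qed

end

text \<open>The exponents in question, \<beta> times a length minus 1, may have either sign. The
  absolute value covers both at once, so a factor of the density whose base stays away from 0 is
  bounded above and below by constants.\<close>

lemma powr_between:
  fixes l y e :: real
  assumes "0 < l" "l \<le> y" "y \<le> 1"
  shows powr_ge_abs: "l powr \<bar>e\<bar> \<le> y powr e" and powr_le_abs: "y powr e \<le> l powr (- \<bar>e\<bar>)"
proof -
  have "l powr \<bar>e\<bar> \<le> 1" "1 \<le> l powr (- \<bar>e\<bar>)"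
    using assms by (auto simp: powr_le_one_le powr_le1 powr_minus one_le_inverse_iff)
  moreover have "y powr e \<le> 1" if "e \<ge> 0" using assms that by (simp add: powr_le1)
  moreover have "1 \<le> y powr e" if "e \<le> 0"
    using assms that powr_mono'[of e 0 y] by simp
  moreover have "l powr e \<le> y powr e" if "e \<ge> 0" using assms that by (intro powr_mono2) auto
  moreover have "y powr e \<le> l powr e" if "e \<le> 0" using assms that by (intro powr_mono2') auto
  ultimately show "l powr \<bar>e\<bar> \<le> y powr e" "y powr e \<le> l powr (- \<bar>e\<bar>)"
    by (cases "e \<ge> 0"; force)+
qed

section \<open>Estimates for the values at one or two times\<close>

definition times1 :: "real \<Rightarrow> nat \<Rightarrow> real" where
  "times1 s i = (if i = 0 then 0 else if i = 1 then s else 1)"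

definition times2 :: "real \<Rightarrow> real \<Rightarrow> nat \<Rightarrow> real" where
  "times2 s s' i = (if i = 0 then 0 else if i = 1 then s else if i = 2 then s' else 1)"

lemma times1_partition:
  assumes "0 < s" "s < 1"
  shows "times1 s 0 = 0" "times1 s (Suc 1) = 1" "\<forall>i\<le>1. times1 s i < times1 s (Suc i)"
  using assms by (auto simp: times1_def)

lemma times2_partition:
  assumes "0 < s" "s < s'" "s' < 1"
  shows "times2 s s' 0 = 0" "times2 s s' (Suc 2) = 1" "\<forall>i\<le>2. times2 s s' i < times2 s s' (Suc i)"
  using assms by (auto simp: times2_def)

lemma ordered_simplex_1:
  "x \<in> ordered_simplex 1 \<longleftrightarrow> x \<in> {1..1} \<rightarrow>\<^sub>E {0..1} \<and> 0 < x 1 \<and> x 1 < 1"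
  unfolding ordered_simplex_def with_endpoints_def by (auto simp: le_Suc_eq)

lemma ordered_simplex_2:
  "x \<in> ordered_simplex 2 \<longleftrightarrow> x \<in> {1..2} \<rightarrow>\<^sub>E {0..1} \<and> 0 < x 1 \<and> x 1 < x 2 \<and> x 2 < 1"
  unfolding ordered_simplex_def with_endpoints_def by (auto simp: le_Suc_eq numeral_2_eq_2)

lemma dirichlet_density_1:
  "dirichlet_density \<beta> 1 (times1 s) x = x 1 powr (\<beta> * s - 1) * (1 - x 1) powr (\<beta> * (1 - s) - 1)"
  by (simp add: dirichlet_density_def times1_def with_endpoints_def atLeast0_atMost_Suc)

lemma dirichlet_density_2:
  "dirichlet_density \<beta> 2 (times2 s s') x = x 1 powr (\<beta> * s - 1) *
     ((x 2 - x 1) powr (\<beta> * (s' - s) - 1) * (1 - x 2) powr (\<beta> * (1 - s') - 1))"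
  by (simp add: dirichlet_density_def times2_def with_endpoints_def atLeast0_atMost_Suc numeral_2_eq_2)

lemma cylinder_1: "cylinder 1 (times1 s) J = {g \<in> G0. g s \<in> J 1}"
  by (auto simp: cylinder_def times1_def)

lemma cylinder_2: "cylinder 2 (times2 s s') J = {g \<in> G0. g s \<in> J 1 \<and> g s' \<in> J 2}"
  by (auto simp: cylinder_def times2_def le_Suc_eq numeral_2_eq_2)

text \<open>As \<open>\<beta> * s \<le> 1\<close>, the power of \<open>x 1\<close> is nonincreasing
  and hence smallest at the right end \<epsilon>. Multiplied by the length
  \<open>\<epsilon> / 2\<close> it gives the exponent \<open>\<beta> * s\<close>. The other factor
  has base at least 1/2. The left end \<open>\<epsilon> / 2\<close> keeps the box inside the open
  simplex.\<close>

lemma entropic_near_0: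
  assumes \<beta>: "\<beta> > 0" and Q: "entropic_measure \<beta> Q" and s: "0 < s" "s < 1" "\<beta> * s \<le> 1"
  obtains c where "c > 0" "\<And>\<epsilon>. 0 < \<epsilon> \<Longrightarrow> \<epsilon> \<le> 1 / 2 \<Longrightarrow>
    c * \<epsilon> powr (\<beta> * s) \<le> measure Q {g \<in> G0. g s \<in> {\<epsilon> / 2..\<epsilon>}}"
proof
  note part = times1_partition[OF s(1,2)]
  let ?e = "\<beta> * (1 - s) - 1"
  define C where "C = dirichlet_const \<beta> 1 (times1 s)"
  have C: "C > 0" unfolding C_def using dirichlet_const_pos[OF \<beta> part(3)] .
  show "C * (1 / 2) powr \<bar>?e\<bar> / 2 > 0" using C by simp
  fix \<epsilon> :: real assume \<epsilon>: "0 < \<epsilon>" "\<epsilon> \<le> 1 / 2"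
  have "C * ((\<epsilon> powr (\<beta> * s - 1) * (1 / 2) powr \<bar>?e\<bar>) * (\<Prod>i=1..1::nat. \<epsilon> - \<epsilon> / 2))
      \<le> measure Q (cylinder 1 (times1 s) (\<lambda>i. {\<epsilon> / 2..\<epsilon>}))"
    unfolding C_def
  proof (rule cylinder_prob_ge[OF \<beta> Q part])
    fix x :: "nat \<Rightarrow> real" assume x: "x \<in> {1..1} \<rightarrow>\<^sub>E {\<epsilon> / 2..\<epsilon>}"
    then have x1: "\<epsilon> / 2 \<le> x 1" "x 1 \<le> \<epsilon>" by (auto simp: PiE_iff)
    have "\<epsilon> powr (\<beta> * s - 1) \<le> x 1 powr (\<beta> * s - 1)"
      using x1 \<epsilon> s by (intro powr_mono2') auto
    moreover have "(1 / 2) powr \<bar>?e\<bar> \<le> (1 - x 1) powr ?e"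
      using x1 \<epsilon> by (intro powr_ge_abs) auto
    ultimately have "\<epsilon> powr (\<beta> * s - 1) * (1 / 2) powr \<bar>?e\<bar> \<le> dirichlet_density \<beta> 1 (times1 s) x"
      unfolding dirichlet_density_1 by (intro mult_mono) auto
    moreover have "x \<in> ordered_simplex 1"
      unfolding ordered_simplex_1 using x x1 \<epsilon> by (auto simp: PiE_iff)
    ultimately show "x \<in> ordered_simplex 1 \<and>
        \<epsilon> powr (\<beta> * s - 1) * (1 / 2) powr \<bar>?e\<bar> \<le> dirichlet_density \<beta> 1 (times1 s) x" by blast
  qed (use \<epsilon> in auto)
  moreover have "\<epsilon> powr (\<beta> * s) = \<epsilon> powr (\<beta> * s - 1) * \<epsilon>"
    using \<epsilon> by (simp add: powr_diff)
  ultimately show "C * (1 / 2) powr \<bar>?e\<bar> / 2 * \<epsilon> powr (\<beta> * s) \<le> measure Q {g \<in> G0. g s \<in> {\<epsilon> / 2..\<epsilon>}}"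
    unfolding cylinder_1 by (simp add: ac_simps)
qed

text \<open>For \<open>\<epsilon> \<le> 1 / 8\<close> the window lies in [1/8, 1/2], where the
  density is bounded, and its length is \<open>3 * \<epsilon>\<close>. The window is asymmetric
  because the midpoints in question fill [1/4, 1/4 + \<epsilon>], and a margin \<epsilon> is added
  on both sides.\<close>

lemma entropic_near_quarter:
  assumes \<beta>: "\<beta> > 0" and Q: "entropic_measure \<beta> Q" and s: "0 < s" "s < 1"
  obtains c where "c > 0" "\<And>\<epsilon>. 0 < \<epsilon> \<Longrightarrow> \<epsilon> \<le> 1 / 8 \<Longrightarrow>
    measure Q {g \<in> G0. g s \<in> {1 / 4 - \<epsilon>..1 / 4 + 2 * \<epsilon>}} \<le> c * \<epsilon>"
proof
  note part = times1_partition[OF s(1,2)]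
  let ?e = "\<beta> * s - 1" and ?e' = "\<beta> * (1 - s) - 1"
  define C where "C = dirichlet_const \<beta> 1 (times1 s)"
  define D where "D = (1 / 8) powr (- \<bar>?e\<bar>) * (1 / 2) powr (- \<bar>?e'\<bar>)"
  have C: "C > 0" unfolding C_def using dirichlet_const_pos[OF \<beta> part(3)] .
  then show "C * (D * 3) > 0" by (simp add: D_def)
  fix \<epsilon> :: real assume \<epsilon>: "0 < \<epsilon>" "\<epsilon> \<le> 1 / 8"
  have "measure Q (cylinder 1 (times1 s) (\<lambda>i. {1 / 4 - \<epsilon>..1 / 4 + 2 * \<epsilon>}))
      \<le> C * (D * (\<Prod>i=1..1::nat. (1 / 4 + 2 * \<epsilon>) - (1 / 4 - \<epsilon>)))"
    unfolding C_def
  proof (rule cylinder_prob_le[OF \<beta> Q part])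
    fix x :: "nat \<Rightarrow> real" assume x: "x \<in> {1..1} \<rightarrow>\<^sub>E {1 / 4 - \<epsilon>..1 / 4 + 2 * \<epsilon>}"
    then have x1: "1 / 4 - \<epsilon> \<le> x 1" "x 1 \<le> 1 / 4 + 2 * \<epsilon>" by (auto simp: PiE_iff)
    have "x 1 powr ?e \<le> (1 / 8) powr (- \<bar>?e\<bar>)"
      using x1 \<epsilon> by (intro powr_le_abs) auto
    moreover have "(1 - x 1) powr ?e' \<le> (1 / 2) powr (- \<bar>?e'\<bar>)"
      using x1 \<epsilon> by (intro powr_le_abs) auto
    ultimately show "dirichlet_density \<beta> 1 (times1 s) x \<le> D"
      unfolding dirichlet_density_1 D_def by (intro mult_mono) auto
  qed (use \<epsilon> in \<open>auto simp: D_def\<close>)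
  then show "measure Q {g \<in> G0. g s \<in> {1 / 4 - \<epsilon>..1 / 4 + 2 * \<epsilon>}} \<le> C * (D * 3) * \<epsilon>"
    unfolding cylinder_1 by (simp add: algebra_simps)
qed

text \<open>The two intervals are \<open>\<epsilon> / 4\<close> apart, which puts the box in the
  open simplex and keeps the increment positive and at most \<epsilon>. As
  \<open>\<beta> * (s' - s) \<le> 1\<close>, the factor of the increment is at least its value at
  \<epsilon>; the area \<open>\<epsilon> * \<epsilon> / 8\<close> of the box raises the exponent by
  2.\<close>

lemma entropic_flat_at_half:
  assumes \<beta>: "\<beta> > 0" and Q: "entropic_measure \<beta> Q" and s: "0 < s" "s < s'" "s' < 1" "\<beta> * (s' - s) \<le> 1"
  obtains c where "c > 0" "\<And>\<epsilon>. 0 < \<epsilon> \<Longrightarrow> \<epsilon> \<le> 1 / 4 \<Longrightarrow>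
    c * \<epsilon> powr (1 + \<beta> * (s' - s)) \<le>
      measure Q {g \<in> G0. g s \<in> {1 / 2..1 / 2 + \<epsilon> / 4} \<and> g s' \<in> {1 / 2 + \<epsilon> / 2..1 / 2 + \<epsilon>}}"
proof
  note part = times2_partition[OF s(1-3)]
  let ?e = "\<beta> * s - 1" and ?q = "\<beta> * (s' - s)" and ?e' = "\<beta> * (1 - s') - 1"
  define C where "C = dirichlet_const \<beta> 2 (times2 s s')"
  define D where "D = (1 / 2) powr \<bar>?e\<bar> * (1 / 4) powr \<bar>?e'\<bar>"
  have C: "C > 0" unfolding C_def using dirichlet_const_pos[OF \<beta> part(3)] .
  then show "C * D / 8 > 0" by (simp add: D_def)
  fix \<epsilon> :: real assume \<epsilon>: "0 < \<epsilon>" "\<epsilon> \<le> 1 / 4"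
  define a where "a = (\<lambda>i::nat. if i = 1 then 1 / 2 else 1 / 2 + \<epsilon> / 2)"
  define b where "b = (\<lambda>i::nat. if i = 1 then 1 / 2 + \<epsilon> / 4 else 1 / 2 + \<epsilon>)"
  have mass: "C * ((D * \<epsilon> powr (?q - 1)) * (\<Prod>i=1..2::nat. b i - a i))
      \<le> measure Q (cylinder 2 (times2 s s') (\<lambda>i. {a i..b i}))"
    unfolding C_def
  proof (rule cylinder_prob_ge[OF \<beta> Q part])
    fix x :: "nat \<Rightarrow> real" assume x: "x \<in> PiE {1..2} (\<lambda>i. {a i..b i})"
    have "x 1 \<in> {a 1..b 1}" "x 2 \<in> {a 2..b 2}" using x by (auto simp: PiE_iff)
    then have x1: "1 / 2 \<le> x 1" "x 1 \<le> 1 / 2 + \<epsilon> / 4"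
      and x2: "1 / 2 + \<epsilon> / 2 \<le> x 2" "x 2 \<le> 1 / 2 + \<epsilon>"
      by (auto simp: a_def b_def)
    have "(1 / 2) powr \<bar>?e\<bar> \<le> x 1 powr ?e"
      using x1 \<epsilon> by (intro powr_ge_abs) auto
    moreover have "\<epsilon> powr (?q - 1) \<le> (x 2 - x 1) powr (?q - 1)"
      using x1 x2 \<epsilon> s by (intro powr_mono2') auto
    moreover have "(1 / 4) powr \<bar>?e'\<bar> \<le> (1 - x 2) powr ?e'"
      using x2 \<epsilon> by (intro powr_ge_abs) auto
    ultimately have "(1 / 2) powr \<bar>?e\<bar> * (\<epsilon> powr (?q - 1) * (1 / 4) powr \<bar>?e'\<bar>) \<le> dirichlet_density \<beta> 2 (times2 s s') x"
      unfolding dirichlet_density_2 by (intro mult_mono) auto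
    then have "D * \<epsilon> powr (?q - 1) \<le> dirichlet_density \<beta> 2 (times2 s s') x"
      by (simp add: D_def ac_simps)
    moreover have "x \<in> ordered_simplex 2"
    proof -
      have "x i \<in> {0..1}" if "i \<in> {1..2}" for i
      proof -
        have "i = 1 \<or> i = 2" using that by auto
        then show ?thesis using x1 x2 \<epsilon> by auto
      qed
      moreover have "x \<in> extensional {1..2}" using x by (auto simp: PiE_iff)
      ultimately have "x \<in> {1..2} \<rightarrow>\<^sub>E {0..1}" unfolding PiE_iff by blast
      then show ?thesis unfolding ordered_simplex_2 using x1 x2 \<epsilon> by auto
    qed
    ultimately show "x \<in> ordered_simplex 2 \<and>
        D * \<epsilon> powr (?q - 1) \<le> dirichlet_density \<beta> 2 (times2 s s') x" by blast
  qed (use \<epsilon> in \<open>auto simp: a_def b_def\<close>)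
  have vol: "(\<Prod>i=1..2::nat. b i - a i) = \<epsilon> * \<epsilon> / 8"
    by (simp add: a_def b_def numeral_2_eq_2)
  have pow: "\<epsilon> powr (1 + ?q) = \<epsilon> powr (?q - 1) * (\<epsilon> * \<epsilon>)"
    using \<epsilon> by (simp add: powr_diff powr_add)
  show "C * D / 8 * \<epsilon> powr (1 + ?q) \<le>
      measure Q {g \<in> G0. g s \<in> {1 / 2..1 / 2 + \<epsilon> / 4} \<and> g s' \<in> {1 / 2 + \<epsilon> / 2..1 / 2 + \<epsilon>}}"
    using mass unfolding vol pow cylinder_2 by (simp add: a_def b_def ac_simps)
qed

section \<open>Failure of displacement convexity\<close>

lemma uniform_measure_borel_G0:
  assumes Q: "entropic_measure \<beta> Q" and A: "A \<in> sets Q" "measure Q A > 0"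
  shows "uniform_measure Q A \<in> borel_prob_measures (Metric_space.mtopology G0 L2_dist)"
    and "absolutely_continuous Q (uniform_measure Q A)"
    and "AE x in uniform_measure Q A. x \<in> A"
proof -
  interpret Q: prob_space Q using entropic_measureD(1)[OF Q] .
  have "prob_space (uniform_measure Q A)"
    using A by (intro prob_space_uniform_measure) (auto simp: Q.emeasure_eq_measure)
  then show "uniform_measure Q A \<in> borel_prob_measures (Metric_space.mtopology G0 L2_dist)"
    using entropic_measureD(2)[OF Q] by (simp add: borel_prob_measures_def)
  show "absolutely_continuous Q (uniform_measure Q A)"
    unfolding uniform_measure_def using A by (intro absolutely_continuousI_density) simp
  show "AE x in uniform_measure Q A. x \<in> A"
    using A by (intro AE_uniform_measureI) auto
qed

text \<open>The L2 distance does not see the value at the single time \<open>m\<close>, but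
  monotonicity spreads a deviation there: if \<open>y m\<close> is too small, \<open>y\<close> is
  too small on all of \<open>[p, m)\<close>, and if \<open>y m\<close> is too large,
  \<open>y\<close> is too large on all of \<open>[m, q)\<close>. This is why \<open>m\<close> lies
  strictly between the times at which \<open>A0\<close> and \<open>A1\<close> are
  controlled.\<close>

lemma midpoint_concentration:
  assumes Q: "entropic_measure \<beta> Q"
    and s: "0 \<le> p" "p < m" "m < q" "q \<le> 1" and \<epsilon>: "\<epsilon> > 0"
    and bp: "\<mu> \<in> borel_prob_measures (Metric_space.mtopology G0 L2_dist)"
      "\<nu> \<in> borel_prob_measures (Metric_space.mtopology G0 L2_dist)"
      "\<xi> \<in> borel_prob_measures (Metric_space.mtopology G0 L2_dist)"
    and W: "wasserstein_dist G0 L2_dist \<mu> \<nu> = wasserstein_dist G0 L2_dist \<mu> \<xi> / 2"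
      "wasserstein_dist G0 L2_dist \<nu> \<xi> = wasserstein_dist G0 L2_dist \<mu> \<xi> / 2"
    and \<mu>: "A0 \<in> sets borel_G0" "AE g in \<mu>. g \<in> A0" "\<And>g. g \<in> A0 \<Longrightarrow> g q \<le> \<epsilon>"
    and \<xi>: "A1 \<in> sets borel_G0" "AE g in \<xi>. g \<in> A1" "\<And>g. g \<in> A1 \<Longrightarrow> 1 / 2 \<le> g p \<and> g q \<le> 1 / 2 + \<epsilon>"
  shows "AE g in \<nu>. g \<in> {g \<in> G0. g m \<in> {1 / 4 - \<epsilon>..1 / 4 + 2 * \<epsilon>}}"
proof -
  define S where "S = {g \<in> G0. g m \<notin> {1 / 4 - \<epsilon>..1 / 4 + 2 * \<epsilon>}}"
  have [measurable]: "(\<lambda>g. g m) \<in> borel_measurable borel_G0"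
    using s by (intro measurable_G0_eval) auto
  have "{g \<in> space borel_G0. g m \<notin> {1 / 4 - \<epsilon>..1 / 4 + 2 * \<epsilon>}} \<in> sets borel_G0"
    by measurable
  then have S: "S \<in> sets borel_G0" by (simp add: S_def)
  \<comment> \<open>\<open>midpoint_null\<close> requires one gap for all triples, hence a length
    that fits into both intervals.\<close>
  define \<delta> where "\<delta> = min (m - p) (q - m)"
  have \<delta>: "\<delta> > 0" "p + \<delta> \<le> m" "m + \<delta> \<le> q" using s by (auto simp: \<delta>_def)
  have "emeasure \<nu> S = 0"
  proof (rule G0.midpoint_null[OF bp W S \<mu>(1,2) \<xi>(1,2)])
    show "\<epsilon>\<^sup>2 * \<delta> > 0" using \<epsilon> \<delta> by simp
    fix x y z assume x: "x \<in> A0" and y: "y \<in> S" and z: "z \<in> A1"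
    have G: "x \<in> G0" "y \<in> G0" "z \<in> G0"
      using x y z sets.sets_into_space[OF \<mu>(1)] sets.sets_into_space[OF \<xi>(1)] by (auto simp: S_def)
    \<comment> \<open>On \<open>[p, q]\<close> monotonicity places \<open>x\<close> between 0 and
      \<epsilon>, and \<open>z\<close> between \<open>1 / 2\<close> and
      \<open>1 / 2 + \<epsilon>\<close>.\<close>
    have mid: "1 / 4 \<le> (x t + z t) / 2 \<and> (x t + z t) / 2 \<le> 1 / 4 + \<epsilon>" if t: "p \<le> t" "t \<le> q" for t
    proof -
      have "0 \<le> x t" using G0_range[OF G(1), of t] t s by auto
      moreover have "x t \<le> x q" by (rule G0_mono[OF G(1)]) (use t s in auto)
      moreover have "z t \<le> z q" by (rule G0_mono[OF G(3)]) (use t s in auto)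
      moreover have "z p \<le> z t" by (rule G0_mono[OF G(3)]) (use t s in auto)
      ultimately show ?thesis using \<mu>(3)[OF x] \<xi>(3)[OF z] by auto
    qed
    show "(L2_dist x z)\<^sup>2 / 4 + \<epsilon>\<^sup>2 * \<delta> \<le> (L2_dist x y)\<^sup>2 / 2 + (L2_dist y z)\<^sup>2 / 2"
    proof (cases "y m < 1 / 4")
      case True
      then have y2: "y m < 1 / 4 - \<epsilon>" using y \<epsilon> by (auto simp: S_def)
      have "(L2_dist x z)\<^sup>2 / 4 + \<epsilon>\<^sup>2 * ((p + \<delta>) - p) \<le> (L2_dist x y)\<^sup>2 / 2 + (L2_dist y z)\<^sup>2 / 2"
      proof (rule L2_dist_midpoint_gap[OF G])
        fix t assume t: "p \<le> t" "t < p + \<delta>"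
        have "y t \<le> y m" by (rule G0_mono[OF G(2)]) (use t s \<delta> in auto)
        moreover have "1 / 4 \<le> (x t + z t) / 2" using mid[of t] t \<delta> s by auto
        ultimately show "\<epsilon> \<le> \<bar>y t - (x t + z t) / 2\<bar>" using y2 by argo
      qed (use s \<delta> \<epsilon> in auto)
      then show ?thesis by simp
    next
      case False
      then have y2: "y m > 1 / 4 + 2 * \<epsilon>" using y \<epsilon> by (auto simp: S_def)
      have "(L2_dist x z)\<^sup>2 / 4 + \<epsilon>\<^sup>2 * ((m + \<delta>) - m) \<le> (L2_dist x y)\<^sup>2 / 2 + (L2_dist y z)\<^sup>2 / 2"
      proof (rule L2_dist_midpoint_gap[OF G])
        fix t assume t: "m \<le> t" "t < m + \<delta>"
        have "y m \<le> y t" by (rule G0_mono[OF G(2)]) (use t s \<delta> in auto)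
        moreover have "(x t + z t) / 2 \<le> 1 / 4 + \<epsilon>" using mid[of t] t \<delta> s by auto
        ultimately show "\<epsilon> \<le> \<bar>y t - (x t + z t) / 2\<bar>" using y2 by argo
      qed (use s \<delta> \<epsilon> in auto)
      then show ?thesis by simp
    qed
  qed
  then have "AE g in \<nu>. g \<notin> S"
    using S bp(2) by (intro AE_I[where N=S]) (auto simp: borel_prob_measures_def)
  moreover have "AE g in \<nu>. g \<in> G0"
  proof -
    have "space \<nu> = G0"
      using bp(2) sets_eq_imp_space_eq[of \<nu> borel_G0] by (simp add: borel_prob_measures_def)
    then show ?thesis using AE_space[of \<nu>] by simp
  qed
  ultimately show ?thesis by eventually_elim (auto simp: S_def)
qed

theorem theorem8p10:
  "\<not> (\<exists>(K :: real) (\<beta> :: real) Q. \<beta> > 0 \<and> entropic_measure \<beta> Q \<and>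
        generalized_Ricci_ge G0 L2_dist Q K)"
proof clarify
  fix K \<beta> :: real and Q
  assume \<beta>: "\<beta> > 0" and Q: "entropic_measure \<beta> Q" and Ric: "generalized_Ricci_ge G0 L2_dist Q K"
  interpret Q: prob_space Q using entropic_measureD(1)[OF Q] .
  let ?W = "wasserstein_dist G0 L2_dist"
  \<comment> \<open>The times are \<open>s / 3\<close>, \<open>2 * s / 3\<close> and
    \<open>s\<close>. With \<open>\<beta> * s \<le> 1 / 4\<close> the mass exponents of
    \<open>A0\<close> and \<open>A1\<close> are at most 1/4 and 5/4, with mean at most 3/4, below
    the exponent 1 of \<open>H\<close>.\<close>
  define s where "s = min (1 / 2) (1 / (4 * \<beta>))"
  have s: "0 < s" "s < 1" "\<beta> * s \<le> 1 / 4"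
  proof -
    show "0 < s" "s < 1" using \<beta> by (auto simp: s_def)
    have "\<beta> * s \<le> \<beta> * (1 / (4 * \<beta>))" using \<beta> by (intro mult_left_mono) (auto simp: s_def)
    then show "\<beta> * s \<le> 1 / 4" using \<beta> by simp
  qed
  have q: "\<beta> * (s - s / 3) \<le> 1 / 4"
    using s mult_left_mono[of "s - s / 3" s \<beta>] \<beta> by simp
  obtain c0 where c0: "c0 > 0" "\<And>\<epsilon>. 0 < \<epsilon> \<Longrightarrow> \<epsilon> \<le> 1 / 2 \<Longrightarrow>
      c0 * \<epsilon> powr (\<beta> * s) \<le> measure Q {g \<in> G0. g s \<in> {\<epsilon> / 2..\<epsilon>}}"
    by (rule entropic_near_0[OF \<beta> Q s(1,2)]) (use s in auto)
  obtain c1 where c1: "c1 > 0" "\<And>\<epsilon>. 0 < \<epsilon> \<Longrightarrow> \<epsilon> \<le> 1 / 4 \<Longrightarrow>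
      c1 * \<epsilon> powr (1 + \<beta> * (s - s / 3)) \<le>
      measure Q {g \<in> G0. g (s / 3) \<in> {1 / 2..1 / 2 + \<epsilon> / 4} \<and> g s \<in> {1 / 2 + \<epsilon> / 2..1 / 2 + \<epsilon>}}"
    by (rule entropic_flat_at_half[OF \<beta> Q, of "s / 3" s]) (use s q in auto)
  obtain c2 where c2: "c2 > 0" "\<And>\<epsilon>. 0 < \<epsilon> \<Longrightarrow> \<epsilon> \<le> 1 / 8 \<Longrightarrow>
      measure Q {g \<in> G0. g (2 * s / 3) \<in> {1 / 4 - \<epsilon>..1 / 4 + 2 * \<epsilon>}} \<le> c2 * \<epsilon>"
    by (rule entropic_near_quarter[OF \<beta> Q, of "2 * s / 3"]) (use s in auto)
  \<comment> \<open>\<open>D\<close> collects all constants: the entropy inequality at time 1/2 will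
    give \<open>- ln \<epsilon> / 4 \<le> D\<close>, where the factor 1/4 is 1 - 3/4. The choice of
    \<epsilon> violates this, and the bound 1/8 keeps it in the range of all three mass
    estimates.\<close>
  define D where "D = ln c2 - (ln c0 + ln c1) / 2 + \<bar>K\<bar> / 8"
  define \<epsilon> where "\<epsilon> = min (1 / 8) (exp (- 4 * D - 1))"
  have \<epsilon>: "0 < \<epsilon>" "\<epsilon> \<le> 1 / 8" by (auto simp: \<epsilon>_def)
  have "ln \<epsilon> \<le> ln (exp (- 4 * D - 1))" using \<epsilon> by (subst ln_le_cancel_iff) (auto simp: \<epsilon>_def)
  then have ln\<epsilon>: "ln \<epsilon> \<le> - 4 * D - 1" by simp
  define A0 where "A0 = {g \<in> G0. g s \<in> {\<epsilon> / 2..\<epsilon>}}"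
  define A1 where "A1 = {g \<in> G0. g (s / 3) \<in> {1 / 2..1 / 2 + \<epsilon> / 4} \<and> g s \<in> {1 / 2 + \<epsilon> / 2..1 / 2 + \<epsilon>}}"
  define H where "H = {g \<in> G0. g (2 * s / 3) \<in> {1 / 4 - \<epsilon>..1 / 4 + 2 * \<epsilon>}}"
  have [measurable]: "(\<lambda>g. g s) \<in> borel_measurable borel_G0"
      "(\<lambda>g. g (s / 3)) \<in> borel_measurable borel_G0" "(\<lambda>g. g (2 * s / 3)) \<in> borel_measurable borel_G0"
    using s by (auto intro!: measurable_G0_eval)
  have "{g \<in> space borel_G0. g s \<in> {\<epsilon> / 2..\<epsilon>}} \<in> sets borel_G0"
    "{g \<in> space borel_G0. g (s / 3) \<in> {1 / 2..1 / 2 + \<epsilon> / 4} \<and> g s \<in> {1 / 2 + \<epsilon> / 2..1 / 2 + \<epsilon>}} \<in> sets borel_G0"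
    "{g \<in> space borel_G0. g (2 * s / 3) \<in> {1 / 4 - \<epsilon>..1 / 4 + 2 * \<epsilon>}} \<in> sets borel_G0"
    by measurable
  then have sets: "A0 \<in> sets borel_G0" "A1 \<in> sets borel_G0" "H \<in> sets borel_G0"
    unfolding A0_def A1_def H_def by (simp_all only: space_borel_G0)
  have setsQ: "A0 \<in> sets Q" "A1 \<in> sets Q" "H \<in> sets Q"
    using sets by (simp_all add: entropic_measureD(2)[OF Q])
  have m0: "c0 * \<epsilon> powr (\<beta> * s) \<le> measure Q A0"
    using c0(2)[of \<epsilon>] \<epsilon> by (simp add: A0_def)
  have m1: "c1 * \<epsilon> powr (1 + \<beta> * (s - s / 3)) \<le> measure Q A1"
    using c1(2)[of \<epsilon>] \<epsilon> unfolding A1_def by linarith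
  have mH: "measure Q H \<le> c2 * \<epsilon>"
    using c2(2)[of \<epsilon>] \<epsilon> by (simp add: H_def)
  have pos: "measure Q A0 > 0" "measure Q A1 > 0"
    using less_le_trans[OF _ m0] less_le_trans[OF _ m1] c0(1) c1(1) \<epsilon> by auto
  define \<mu>0 where "\<mu>0 = uniform_measure Q A0"
  define \<mu>1 where "\<mu>1 = uniform_measure Q A1"
  note u0 = uniform_measure_borel_G0[OF Q setsQ(1) pos(1), folded \<mu>0_def]
  note u1 = uniform_measure_borel_G0[OF Q setsQ(2) pos(2), folded \<mu>1_def]
  obtain \<mu> where geo: "wasserstein_geodesic G0 L2_dist \<mu> \<mu>0 \<mu>1"
    and conv: "\<forall>t\<in>{0..1}. relative_entropy (\<mu> t) Q
              \<le> ereal t * relative_entropy \<mu>1 Q + ereal (1 - t) * relative_entropy \<mu>0 Q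
                - ereal (K / 2 * t * (1 - t) * (?W \<mu>0 \<mu>1)\<^sup>2)"
    using Ric u0(1,2) u1(1,2) unfolding generalized_Ricci_ge_def by blast
  define \<nu> where "\<nu> = \<mu> (1 / 2)"
  have \<nu>: "\<nu> \<in> borel_prob_measures (Metric_space.mtopology G0 L2_dist)"
    and W: "?W \<mu>0 \<nu> = ?W \<mu>0 \<mu>1 / 2" "?W \<nu> \<mu>1 = ?W \<mu>0 \<mu>1 / 2"
  proof -
    have e: "\<mu> 0 = \<mu>0" "\<mu> 1 = \<mu>1"
      and d: "\<And>s t. s \<in> {0..1} \<Longrightarrow> t \<in> {0..1} \<Longrightarrow> ?W (\<mu> s) (\<mu> t) = \<bar>s - t\<bar> * ?W \<mu>0 \<mu>1"
      using geo by (auto simp: wasserstein_geodesic_def)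
    show "?W \<mu>0 \<nu> = ?W \<mu>0 \<mu>1 / 2" using d[of 0 "1 / 2"] by (simp add: e \<nu>_def)
    show "?W \<nu> \<mu>1 = ?W \<mu>0 \<mu>1 / 2" using d[of "1 / 2" 1] by (simp add: e \<nu>_def)
    show "\<nu> \<in> borel_prob_measures (Metric_space.mtopology G0 L2_dist)"
      using geo by (auto simp: wasserstein_geodesic_def \<nu>_def)
  qed
  have "AE g in \<nu>. g \<in> H"
    unfolding H_def
    by (rule midpoint_concentration[where p = "s / 3" and q = s,
          OF Q _ _ _ _ _ u0(1) \<nu> u1(1) W sets(1) u0(3) _ sets(2) u1(3)])
      (use s \<epsilon> in \<open>auto simp: A0_def A1_def\<close>)
  moreover have "prob_space \<nu>" "sets \<nu> = sets Q"
    using \<nu> entropic_measureD(2)[OF Q] by (auto simp: borel_prob_measures_def)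
  ultimately have "ereal (ln (1 / (c2 * \<epsilon>))) \<le> relative_entropy \<nu> Q"
    using c2(1) \<epsilon> by (intro relative_entropy_ge_concentrated[OF Q.prob_space_axioms _ _ setsQ(3) _ mH]) auto
  also have "\<dots> \<le> ereal (1 / 2) * relative_entropy \<mu>1 Q + ereal (1 - 1 / 2) * relative_entropy \<mu>0 Q
      - ereal (K / 2 * (1 / 2) * (1 - 1 / 2) * (?W \<mu>0 \<mu>1)\<^sup>2)"
    unfolding \<nu>_def using conv by (rule bspec) auto
  also have "\<dots> = ereal (ln (1 / measure Q A1) / 2 + ln (1 / measure Q A0) / 2 - K / 8 * (?W \<mu>0 \<mu>1)\<^sup>2)"
    unfolding \<mu>0_def \<mu>1_def
    using relative_entropy_uniform_measure[OF Q.prob_space_axioms setsQ(1) pos(1)]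
      relative_entropy_uniform_measure[OF Q.prob_space_axioms setsQ(2) pos(2)] by simp
  finally have "ln (1 / (c2 * \<epsilon>)) \<le>
      ln (1 / measure Q A1) / 2 + ln (1 / measure Q A0) / 2 - K / 8 * (?W \<mu>0 \<mu>1)\<^sup>2"
    by simp
  \<comment> \<open>At time 1/2 the curvature term has the factor
    \<open>K / 2 * (1 / 2) * (1 / 2)\<close>, and the Wasserstein distance is at most 1. Taking the
    absolute value covers both signs of \<open>K\<close>.\<close>
  moreover have "- (K / 8 * (?W \<mu>0 \<mu>1)\<^sup>2) \<le> \<bar>K\<bar> / 8"
  proof -
    have "\<bar>K / 8 * (?W \<mu>0 \<mu>1)\<^sup>2\<bar> \<le> \<bar>K / 8\<bar> * 1"
      unfolding abs_mult using G0.wasserstein_dist_bounds[OF u0(1) u1(1)] by (intro mult_left_mono) auto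
    then show ?thesis by auto
  qed
  moreover have "ln (1 / (c2 * \<epsilon>)) = - ln c2 - ln \<epsilon>"
    using c2(1) \<epsilon> by (simp add: ln_div ln_mult)
  moreover have "ln (1 / measure Q A0) \<le> - ln c0 - ln \<epsilon> / 4"
  proof -
    have "ln (c0 * \<epsilon> powr (\<beta> * s)) \<le> ln (measure Q A0)"
      using m0 c0(1) \<epsilon> pos by (subst ln_le_cancel_iff) auto
    moreover have "ln (c0 * \<epsilon> powr (\<beta> * s)) = ln c0 + \<beta> * s * ln \<epsilon>"
      using c0(1) \<epsilon> by (subst ln_mult) (auto simp: ln_powr)
    \<comment> \<open>The logarithm of \<epsilon> is negative, so the upper bound on the exponent
      turns into a lower bound here.\<close>
    moreover have "1 / 4 * ln \<epsilon> \<le> \<beta> * s * ln \<epsilon>"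
      using s(3) \<epsilon> by (intro mult_right_mono_neg) auto
    moreover have "ln (1 / measure Q A0) = - ln (measure Q A0)" using pos by (simp add: ln_div)
    ultimately show ?thesis by linarith
  qed
  moreover have "ln (1 / measure Q A1) \<le> - ln c1 - 5 / 4 * ln \<epsilon>"
  proof -
    define r where "r = 1 + \<beta> * (s - s / 3)"
    have "ln (c1 * \<epsilon> powr r) \<le> ln (measure Q A1)"
      using m1 c1(1) \<epsilon> pos unfolding r_def by (subst ln_le_cancel_iff) auto
    moreover have "ln (c1 * \<epsilon> powr r) = ln c1 + r * ln \<epsilon>"
      using c1(1) \<epsilon> by (subst ln_mult) (auto simp: ln_powr)
    moreover have "5 / 4 * ln \<epsilon> \<le> r * ln \<epsilon>"
      using q \<epsilon> unfolding r_def by (intro mult_right_mono_neg) auto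
    moreover have "ln (1 / measure Q A1) = - ln (measure Q A1)" using pos by (simp add: ln_div)
    ultimately show ?thesis by linarith
  qed
  ultimately show False using ln\<epsilon> unfolding D_def by argo
qed

end
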